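(* Let $A$ be an introverted algebra with mean value on $\mathbb{R}^N$, and let $K(\Delta(A))=\bigcap_{s\in\Delta(A)}s\Delta(A)$ be the kernel of the compact topological semigroup $\Delta(A)$. Then: (i) $K(\Delta(A))$ is a compact topological group. (ii) The mean value $M$ on $A$ can be identified as the Haar integral over $K(\Delta(A))$, that is, $M(u)=\int_{K(\Delta(A))}\widehat u\,d\beta$ for all $u\in A$, where $\beta$ is the normalized Haar measure of $K(\Delta(A))$ and $\widehat u$ is the Gelfand transform of $u$.
   Context: $\mathrm{BUC}(\mathbb{R}^N)$ is the Banach algebra (sup norm) of bounded uniformly continuous functions on $\mathbb{R}^N$ (scalar functions are taken real-valued by convention), and $\tau_a u=u(\cdot+a)$. An algebra with mean value on $\mathbb{R}^N$ is a closed subalgebra $A$ of $\mathrm{BUC}(\mathbb{R}^N)$ which contains the constants, is closed under complex conjugation, is translation invariant ($\tau_a u\in A$ for $u\in A$, $a\in\mathbb{R}^N$), and such that every $u\in A$ has a mean value: as $\varepsilon\to0$ the functions $x\mapsto u(x/\varepsilon)$ converge weak$*$ in $L^\infty(\mathbb{R}^N)$ to a constant $M(u)$. The spectrum $\Delta(A)$ is the set of nonzero multiplicative linear functionals on $A$, with the relative weak$*$ topology of $A'$; it is compact Hausdorff. The Gelfand transformation $u\mapsto\widehat u$, $\widehat u(s)=s(u)$, is an isometric isomorphism of $A$ onto $\mathcal{C}(\Delta(A))$. For $\mu\in\Delta(A)$ and $f\in A$, put $T_\mu f(x)=\mu(\tau_x f)$, $x\in\mathbb{R}^N$. $A$ is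 introverted if $T_\mu(A)\subset A$ for every $\mu\in\Delta(A)$. In that case $\Delta(A)$, with the multiplication $\mu\nu(f)=\mu(T_\nu f)$ ($f\in A$), is a commutative compact topological semigroup (Hausdorff, with identity, separately continuous multiplication). Its kernel $K(\Delta(A))$, defined in the claim, is nonempty and is the smallest ideal of $\Delta(A)$.
   Formalization: Commutativity of the multiplication of Δ(A) is assumed explicitly: the background asserts it for every introverted algebra, but it can fail (functions asymptotic to F(√|x|), F periodic), and then K(Δ(A)) need not be a group. *)

theory Defs
  imports "HOL-Analysis.Analysis" "HOL-Algebra.Group"
begin

definition buc :: "(real ^ 'n \<Rightarrow> real) set" where
  "buc = {u. bounded (range u) \<and> uniformly_continuous_on UNIV u}"

definition translate :: "real ^ 'n \<Rightarrow> (real ^ 'n \<Rightarrow> real) \<Rightarrow> real ^ 'n \<Rightarrow> real" where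
  "translate a u = (\<lambda>x. u (x + a))"

(* Weak* convergence in L^infinity: pairing with every Lebesgue integrable g. *)
definition has_mean_value :: "(real ^ 'n \<Rightarrow> real) \<Rightarrow> real \<Rightarrow> bool" where
  "has_mean_value u m \<longleftrightarrow>
     (\<forall>g. integrable lebesgue g \<longrightarrow>
        ((\<lambda>\<epsilon>. LINT x|lebesgue. u (x /\<^sub>R \<epsilon>) * g x) \<longlongrightarrow> (LINT x|lebesgue. m * g x)) (at_right 0))"

definition mean_value :: "(real ^ 'n \<Rightarrow> real) \<Rightarrow> real" where
  "mean_value u = (THE m. has_mean_value u m)"

(* The sup norm topology is that of the type of bounded continuous functions, of which
   BUC is a closed subspace.  Scalar multiples are products with constants, and complex
   conjugation is the identity on real-valued functions. *)
definition algebra_with_mean_value :: "(real ^ 'n \<Rightarrow> real) set \<Rightarrow> bool" where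
  "algebra_with_mean_value A \<longleftrightarrow>
     A \<subseteq> buc \<and>
     closed {u. apply_bcontfun u \<in> A} \<and>
     (\<forall>c. (\<lambda>x. c) \<in> A) \<and>
     (\<forall>u\<in>A. \<forall>v\<in>A. (\<lambda>x. u x + v x) \<in> A) \<and>
     (\<forall>u\<in>A. \<forall>v\<in>A. (\<lambda>x. u x * v x) \<in> A) \<and>
     (\<forall>u\<in>A. \<forall>a. translate a u \<in> A) \<and>
     (\<forall>u\<in>A. \<exists>m. has_mean_value u m)"

(* Functionals on A are represented by total functions with the fixed value undefined
   outside A, so that equality of functionals is equality on A. *)
definition spectrum :: "(real ^ 'n \<Rightarrow> real) set \<Rightarrow> ((real ^ 'n \<Rightarrow> real) \<Rightarrow> real) set" where
  "spectrum A =
     {s \<in> extensional A.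
        (\<forall>u\<in>A. \<forall>v\<in>A. s (\<lambda>x. u x + v x) = s u + s v) \<and>
        (\<forall>u\<in>A. \<forall>c. s (\<lambda>x. c * u x) = c * s u) \<and>
        (\<forall>u\<in>A. \<forall>v\<in>A. s (\<lambda>x. u x * v x) = s u * s v) \<and>
        (\<exists>u\<in>A. s u \<noteq> 0)}"

(* The weak* topology is the topology of pointwise convergence on A. *)
definition spectrum_topology ::
  "(real ^ 'n \<Rightarrow> real) set \<Rightarrow> ((real ^ 'n \<Rightarrow> real) \<Rightarrow> real) topology" where
  "spectrum_topology A = subtopology (product_topology (\<lambda>u. euclideanreal) A) (spectrum A)"

definition gelfand :: "(real ^ 'n \<Rightarrow> real) \<Rightarrow> ((real ^ 'n \<Rightarrow> real) \<Rightarrow> real) \<Rightarrow> real" where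
  "gelfand u s = s u"

definition introversion ::
  "((real ^ 'n \<Rightarrow> real) \<Rightarrow> real) \<Rightarrow> (real ^ 'n \<Rightarrow> real) \<Rightarrow> real ^ 'n \<Rightarrow> real" where
  "introversion \<mu> f = (\<lambda>x. \<mu> (translate x f))"

definition introverted :: "(real ^ 'n \<Rightarrow> real) set \<Rightarrow> bool" where
  "introverted A \<longleftrightarrow> (\<forall>\<mu>\<in>spectrum A. \<forall>f\<in>A. introversion \<mu> f \<in> A)"

definition spectrum_mult ::
  "(real ^ 'n \<Rightarrow> real) set \<Rightarrow> ((real ^ 'n \<Rightarrow> real) \<Rightarrow> real) \<Rightarrow> ((real ^ 'n \<Rightarrow> real) \<Rightarrow> real)
     \<Rightarrow> (real ^ 'n \<Rightarrow> real) \<Rightarrow> real" where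
  "spectrum_mult A \<mu> \<nu> = (\<lambda>f\<in>A. \<mu> (introversion \<nu> f))"

definition spectrum_kernel :: "(real ^ 'n \<Rightarrow> real) set \<Rightarrow> ((real ^ 'n \<Rightarrow> real) \<Rightarrow> real) set" where
  "spectrum_kernel A = (\<Inter>s\<in>spectrum A. spectrum_mult A s ` spectrum A)"

(* The identity of the kernel is in general not the identity of the whole spectrum. *)
definition kernel_group ::
  "(real ^ 'n \<Rightarrow> real) set \<Rightarrow> ((real ^ 'n \<Rightarrow> real) \<Rightarrow> real) monoid" where
  "kernel_group A =
     \<lparr>carrier = spectrum_kernel A,
      mult = spectrum_mult A,
      one = (THE e. e \<in> spectrum_kernel A \<and>
               (\<forall>s\<in>spectrum_kernel A. spectrum_mult A e s = s \<and> spectrum_mult A s e = s))\<rparr>"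

definition kernel_topology ::
  "(real ^ 'n \<Rightarrow> real) set \<Rightarrow> ((real ^ 'n \<Rightarrow> real) \<Rightarrow> real) topology" where
  "kernel_topology A = subtopology (spectrum_topology A) (spectrum_kernel A)"

definition topological_group_on :: "('a, 'b) monoid_scheme \<Rightarrow> 'a topology \<Rightarrow> bool" where
  "topological_group_on G X \<longleftrightarrow>
     group G \<and> topspace X = carrier G \<and>
     continuous_map (prod_topology X X) X (\<lambda>(x, y). x \<otimes>\<^bsub>G\<^esub> y) \<and>
     continuous_map X X (\<lambda>x. inv\<^bsub>G\<^esub> x)"

definition compact_topological_group :: "('a, 'b) monoid_scheme \<Rightarrow> 'a topology \<Rightarrow> bool" where
  "compact_topological_group G X \<longleftrightarrow>
     topological_group_on G X \<and> compact_space X \<and> Hausdorff_space X"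

(* Left-invariant regular Borel probability measures; on a compact group these are also
   right-invariant.  Regularity is not automatic, since X need not be metrizable. *)
definition normalized_haar_measure ::
  "('a, 'b) monoid_scheme \<Rightarrow> 'a topology \<Rightarrow> 'a measure \<Rightarrow> bool" where
  "normalized_haar_measure G X \<beta> \<longleftrightarrow>
     space \<beta> = topspace X \<and>
     sets \<beta> = sigma_sets (topspace X) {U. openin X U} \<and>
     emeasure \<beta> (space \<beta>) = 1 \<and>
     (\<forall>B\<in>sets \<beta>. emeasure \<beta> B = (INF U\<in>{U. openin X U \<and> B \<subseteq> U}. emeasure \<beta> U)) \<and>
     (\<forall>U. openin X U \<longrightarrow> emeasure \<beta> U = (SUP C\<in>{C. compactin X C \<and> C \<subseteq> U}. emeasure \<beta> C)) \<and>
     (\<forall>g\<in>carrier G. \<forall>B\<in>sets \<beta>. emeasure \<beta> ((\<lambda>x. g \<otimes>\<^bsub>G\<^esub> x) ` B) = emeasure \<beta> B)"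

end

theory Submission
  imports Defs
begin

text \<open>The space \<open>\<real>\<^sup>N\<close> acts on the spectrum \<open>\<Delta>\<close> through the evaluations \<open>\<delta> x\<close>, which are dense; in
  particular \<open>\<Delta>\<close> is separable. The kernel \<open>K\<close> of the commutative compact semigroup \<open>\<Delta>\<close> is
  algebraically a group. A Baire category argument of Namioka type, applied to
  \<open>(x, y) \<mapsto> F (x y)\<close> and using separability in place of metrizability, shows that the translates of a
  continuous \<open>F\<close> are equicontinuous at some point of \<open>K\<close>, hence at every point by homogeneity; this
  gives joint continuity of the multiplication and continuity of the inverse.

  For the mean value, represent \<open>M\<close> on \<open>C(\<Delta>) \<cong> A\<close> by a Radon measure. Each \<open>T\<^sub>\<mu> f\<close> is the pointwise limit
  on \<open>\<Delta>\<close> of a sequence of translates of \<open>f\<close>, so dominated convergence and translation invariance give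
  \<open>M (T\<^sub>\<mu> f) = M f\<close>. With \<open>e\<close> the identity of \<open>K\<close>, the map \<open>s \<mapsto> e s\<close> retracts \<open>\<Delta>\<close> onto \<open>K\<close>, and \<open>M\<close> induces
  through it a \<open>K\<close>-invariant functional on \<open>C(K)\<close> whose Radon measure is the Haar measure.\<close>

section \<open>The Riesz representation theorem on compact Hausdorff spaces\<close>

text \<open>The obstacle is that \<Delta> need not be metrizable: A need not be separable, so points
  of \<Delta> are limits of nets only, and the product is a priori just separately continuous. The
  way out is to test one continuous F at a time. If
  \<open>F (d n \<cdot> y) = F (d n \<cdot> y')\<close> along a dense sequence d, then continuity in
  the left factor gives \<open>F (r \<cdot> y) = F (r \<cdot> y')\<close> for every r, and
  compactness of \<Delta> \<times> \<Delta> makes this implication quantitative. The same estimate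
  feeds the Baire argument and yields, for each F, a genuine sequence of translates, without which
  dominated convergence could not be applied.

  By its definition the product is continuous in the left factor; commutativity supplies the right
  one.

  Uniqueness of the Haar integral enters because the claim concerns every normalized Haar measure,
  whereas the construction from M produces a particular one.\<close>

definition borel_measure_on :: "'a topology \<Rightarrow> 'a measure \<Rightarrow> bool" where
  "borel_measure_on X \<beta> \<longleftrightarrow> space \<beta> = topspace X \<and> sets \<beta> = sigma_sets (topspace X) {U. openin X U}"

lemma borel_measure_on_open:
  "\<lbrakk>borel_measure_on X \<beta>; openin X U\<rbrakk> \<Longrightarrow> U \<in> sets \<beta>"
  by (auto simp: borel_measure_on_def)

lemma borel_measure_on_closed:
  assumes "borel_measure_on X \<beta>" "closedin X C"
  shows "C \<in> sets \<beta>"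
proof -
  have "space \<beta> - (topspace X - C) \<in> sets \<beta>"
    using assms by (intro sets.compl_sets borel_measure_on_open[of X]) auto
  moreover have "space \<beta> - (topspace X - C) = C"
    using assms by (auto simp: borel_measure_on_def closedin_def)
  ultimately show ?thesis by simp
qed

lemma borel_measure_on_measurable:
  fixes f :: "'a \<Rightarrow> real"
  assumes "borel_measure_on X \<beta>" "continuous_map X euclideanreal f"
  shows "f \<in> borel_measurable \<beta>"
proof (rule borel_measurableI)
  fix S :: "real set" assume "open S"
  then have "openin X {x \<in> topspace X. f x \<in> S}"
    using assms(2) by (intro openin_continuous_map_preimage) auto
  moreover have "f -` S \<inter> space \<beta> = {x \<in> topspace X. f x \<in> S}"
    using assms(1) by (auto simp: borel_measure_on_def)
  ultimately show "f -` S \<inter> space \<beta> \<in> sets \<beta>"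
    using assms(1) by (simp add: borel_measure_on_open)
qed

lemma compact_space_real_bounded:
  fixes f :: "'a \<Rightarrow> real"
  assumes "compact_space X" "continuous_map X euclideanreal f"
  obtains B where "B > 0" "\<And>x. x \<in> topspace X \<Longrightarrow> \<bar>f x\<bar> \<le> B"
proof -
  have "compactin euclideanreal (f ` topspace X)"
    using assms by (intro image_compactin) (auto simp: compact_space_def)
  then have "bounded (f ` topspace X)"
    by (simp add: compact_imp_bounded)
  then obtain B where "B > 0" "\<forall>y\<in>f ` topspace X. norm y \<le> B"
    by (auto simp: bounded_pos)
  then show ?thesis using that by auto
qed

lemma borel_measure_on_integrable:
  fixes f :: "'a \<Rightarrow> real"
  assumes "borel_measure_on X \<beta>" "finite_measure \<beta>" "compact_space X" "continuous_map X euclideanreal f"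
  shows "integrable \<beta> f"
proof -
  obtain B where "\<And>x. x \<in> topspace X \<Longrightarrow> \<bar>f x\<bar> \<le> B"
    using compact_space_real_bounded assms(3,4) by blast
  then show ?thesis
    using assms by (intro finite_measure.integrable_const_bound[of _ _ B])
      (auto intro: borel_measure_on_measurable simp: borel_measure_on_def)
qed

text \<open>\<open>I\<close> is a total operation, so functions that agree on
  \<open>topspace X\<close> may be different arguments. Positivity, which looks only at
  \<open>topspace X\<close>, forces \<open>I\<close> to identify continuous ones
  (\<open>I_cong\<close>).\<close>

locale positive_functional =
  fixes X :: "'a topology" and I :: "('a \<Rightarrow> real) \<Rightarrow> real"
  assumes compact: "compact_space X" and Hausdorff: "Hausdorff_space X"
    and add: "\<lbrakk>continuous_map X euclideanreal f; continuous_map X euclideanreal g\<rbrakk>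
                \<Longrightarrow> I (\<lambda>x. f x + g x) = I f + I g"
    and scale: "continuous_map X euclideanreal f \<Longrightarrow> I (\<lambda>x. c * f x) = c * I f"
    and nonneg: "\<lbrakk>continuous_map X euclideanreal f; \<And>x. x \<in> topspace X \<Longrightarrow> 0 \<le> f x\<rbrakk> \<Longrightarrow> 0 \<le> I f"
begin

abbreviation cont :: "('a \<Rightarrow> real) \<Rightarrow> bool" where
  "cont \<equiv> continuous_map X euclideanreal"

lemma mono:
  assumes "cont f" "cont g" "\<And>x. x \<in> topspace X \<Longrightarrow> f x \<le> g x"
  shows "I f \<le> I g"
proof -
  have "0 \<le> I (\<lambda>x. g x + (-1) * f x)"
    by (rule nonneg) (use assms in \<open>auto intro!: continuous_intros\<close>)
  also have "\<dots> = I g + (-1) * I f"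
    using assms scale[of f "-1"] by (subst add) (auto intro!: continuous_intros)
  finally show ?thesis by simp
qed

section \<open>The content of an open set\<close>

definition below :: "'a set \<Rightarrow> ('a \<Rightarrow> real) set" where
  "below U = {f. cont f \<and> (\<forall>x\<in>topspace X. 0 \<le> f x \<and> f x \<le> 1) \<and> (\<forall>x\<in>topspace X - U. f x = 0)}"

definition content :: "'a set \<Rightarrow> real" where
  "content U = (SUP f\<in>below U. I f)"

lemma zero_below: "(\<lambda>x. 0) \<in> below U"
  by (simp add: below_def)

lemma I_below_le: "f \<in> below U \<Longrightarrow> I f \<le> I (\<lambda>x. 1)"
  by (rule mono) (auto simp: below_def)

lemma bdd_above_below: "bdd_above (I ` below U)"
  using I_below_le by (intro bdd_aboveI[of _ "I (\<lambda>x. 1)"]) auto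

lemma below_le_content: "f \<in> below U \<Longrightarrow> I f \<le> content U"
  unfolding content_def by (rule cSUP_upper[OF _ bdd_above_below])

lemma content_least: "(\<And>f. f \<in> below U \<Longrightarrow> I f \<le> c) \<Longrightarrow> content U \<le> c"
  unfolding content_def using zero_below[of U] by (intro cSUP_least) auto

lemma I_zero: "I (\<lambda>x. 0) = 0"
  using scale[of "\<lambda>x. 0" 0] by simp

lemma content_nonneg: "0 \<le> content U"
  using below_le_content[OF zero_below, of U] by (simp add: I_zero)

lemma content_mono: "U \<subseteq> V \<Longrightarrow> content U \<le> content V"
  by (rule content_least, rule below_le_content) (auto simp: below_def)

lemma content_le: "content U \<le> I (\<lambda>x. 1)"
  by (rule content_least, rule I_below_le)

lemma content_topspace: "content (topspace X) = I (\<lambda>x. 1)"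
  using content_le[of "topspace X"] below_le_content[of "\<lambda>x. 1" "topspace X"]
  by (simp add: below_def)

lemma content_empty: "content {} = 0"
proof (rule antisym[OF content_least content_nonneg])
  fix f assume "f \<in> below {}"
  then have "I f \<le> I (\<lambda>x. 0)" by (intro mono) (auto simp: below_def)
  then show "I f \<le> 0" by (simp add: I_zero)
qed

text \<open>\<open>below U\<close> asks only for vanishing off U, not for support inside U. Lowering
  f by e > 0 restores compactness: \<open>chop e f\<close> vanishes off the compact set where f
  \<ge> e, which lies in U, and by \<open>I_le_chop\<close> the loss is at most e times the total
  mass.\<close>

definition chop :: "real \<Rightarrow> ('a \<Rightarrow> real) \<Rightarrow> 'a \<Rightarrow> real" where
  "chop e f = (\<lambda>x. max (f x - e) 0)"

lemma chop_below:
  assumes "f \<in> below V" "e \<ge> 0" "{x \<in> topspace X. f x \<ge> e} \<subseteq> U"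
  shows "chop e f \<in> below U"
  using assms by (fastforce simp: below_def chop_def intro!: continuous_intros)

lemma I_le_chop:
  assumes "f \<in> below V"
  shows "I f \<le> I (chop e f) + e * I (\<lambda>x. 1)"
proof -
  have f: "cont f" using assms by (simp add: below_def)
  then have c: "cont (chop e f)" by (auto simp: chop_def intro!: continuous_intros)
  have "I f \<le> I (\<lambda>x. chop e f x + e * 1)"
    using f c by (intro mono continuous_intros) (auto simp: chop_def)
  also have "\<dots> = I (chop e f) + e * I (\<lambda>x. 1)"
    using c by (subst add, simp, simp) (subst scale, auto)
  finally show ?thesis .
qed

lemma closedin_ge: "cont f \<Longrightarrow> closedin X {x \<in> topspace X. f x \<ge> e}"
  using closedin_continuous_map_preimage[of X euclideanreal f "{e..}"] by auto

lemma openin_gt: "cont f \<Longrightarrow> openin X {x \<in> topspace X. f x > e}"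
  using openin_continuous_map_preimage[of X euclideanreal f "{e<..}"] by auto

lemma le_eps:
  assumes "\<And>e. e > 0 \<Longrightarrow> a \<le> b + e * I (\<lambda>x. 1)"
  shows "a \<le> b"
proof (rule field_le_epsilon)
  fix d :: real assume "d > 0"
  have I1: "0 \<le> I (\<lambda>x. 1)" by (rule nonneg) auto
  \<comment> \<open>The denominator is increased by 1 because the total mass may be 0.\<close>
  have "a \<le> b + d / (I (\<lambda>x. 1) + 1) * I (\<lambda>x. 1)"
    using \<open>d > 0\<close> I1 by (intro assms) auto
  also have "d / (I (\<lambda>x. 1) + 1) * I (\<lambda>x. 1) \<le> d"
    using \<open>d > 0\<close> I1 by (simp add: field_simps)
  finally show "a \<le> b + d" by simp
qed

lemma content_Un:
  assumes "openin X U" "openin X V"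
  shows "content (U \<union> V) \<le> content U + content V"
proof (rule content_least)
  fix f assume f: "f \<in> below (U \<union> V)"
  show "I f \<le> content U + content V"
  proof (rule le_eps)
    fix e :: real assume "e > 0"
    define C where "C = {x \<in> topspace X. f x \<ge> e}"
    have "cont f" using f by (simp add: below_def)
    have C: "closedin X C" unfolding C_def using \<open>cont f\<close> by (rule closedin_ge)
    have CUV: "C \<subseteq> U \<union> V" using f \<open>e > 0\<close> by (force simp: C_def below_def)
    have "normal_space X"
      using compact Hausdorff by (simp add: compact_Hausdorff_or_regular_imp_normal_space)
    \<comment> \<open>h splits g into g h + g (1 - h). The second summand vanishes off V: g is 0 off
      C, and h is 1 on C - V.\<close>
    then obtain h where h: "continuous_map X (top_of_set {0..1}) h"
        "h ` (topspace X - U) \<subseteq> {0::real}" "h ` (C - V) \<subseteq> {1}"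
      using CUV C assms
      by (elim Urysohn_lemma[of X "topspace X - U" "C - V" 0 1]) (auto simp: disjnt_def)
    have hc: "cont h" and h01: "\<And>x. x \<in> topspace X \<Longrightarrow> 0 \<le> h x \<and> h x \<le> 1"
      using h(1) by (auto simp: continuous_map_in_subtopology)
    define g where "g = chop e f"
    have g: "g \<in> below (U \<union> V)" unfolding g_def
      by (rule chop_below[OF f]) (use \<open>e > 0\<close> CUV C_def in auto)
    then have gc: "cont g" by (simp add: below_def)
    have g0: "g x = 0" if "x \<in> topspace X - C" for x
      using that by (auto simp: g_def chop_def C_def)
    have "(\<lambda>x. g x * h x) \<in> below U"
      using g h h01 hc by (auto simp: below_def mult_le_one intro!: continuous_intros)
    moreover have "(\<lambda>x. g x * (1 - h x)) \<in> below V"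
    proof -
      have "g x * (1 - h x) = 0" if "x \<in> topspace X - V" for x
        using that g0[of x] h(3) by (cases "x \<in> C") auto
      then show ?thesis
        using g h h01 hc by (auto simp: below_def intro!: mult_le_one continuous_intros)
    qed
    ultimately have "I (\<lambda>x. g x * h x) + I (\<lambda>x. g x * (1 - h x)) \<le> content U + content V"
      by (intro add_mono below_le_content)
    also have "I (\<lambda>x. g x * h x) + I (\<lambda>x. g x * (1 - h x)) = I g"
      using gc hc by (subst add[symmetric]) (auto intro!: continuous_intros simp: algebra_simps)
    finally show "I f \<le> content U + content V + e * I (\<lambda>x. 1)"
      using I_le_chop[OF f, of e] by (simp add: g_def)
  qed
qed

lemma content_UN_finite:
  assumes "\<And>i::nat. openin X (U i)"
  shows "content (\<Union>i<n. U i) \<le> (\<Sum>i<n. content (U i))"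
proof (induction n)
  case 0
  then show ?case by (simp add: content_empty)
next
  case (Suc n)
  have "content (\<Union>i<Suc n. U i) = content ((\<Union>i<n. U i) \<union> U n)"
    by (simp add: lessThan_Suc Un_commute)
  also have "\<dots> \<le> content (\<Union>i<n. U i) + content (U n)"
    using assms by (intro content_Un) auto
  finally show ?case using Suc by simp
qed

text \<open>Compactness of the set where f \<ge> e reduces the countable cover to a finite one. If
  the right-hand side is infinite, the bound is trivial.\<close>

lemma content_UN:
  assumes U: "\<And>i::nat. openin X (U i)"
  shows "ennreal (content (\<Union>i. U i)) \<le> (\<Sum>i. ennreal (content (U i)))"
proof (cases "(\<Sum>i. ennreal (content (U i))) = Orderings.top")
  case False
  then have s: "summable (\<lambda>i. content (U i))"
    using content_nonneg by (intro summable_suminf_not_top) auto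
  have "content (\<Union>i. U i) \<le> (\<Sum>i. content (U i))"
  proof (rule content_least, rule le_eps)
    fix f and e :: real
    assume f: "f \<in> below (\<Union>i. U i)" and "e > 0"
    define C where "C = {x \<in> topspace X. f x \<ge> e}"
    have "closedin X C" unfolding C_def using f by (intro closedin_ge) (simp add: below_def)
    then have "compactin X C" using compact by (simp add: closedin_compact_space)
    moreover have CU: "C \<subseteq> (\<Union>i. U i)" using f \<open>e > 0\<close> by (force simp: C_def below_def)
    ultimately obtain F where F: "finite F" "F \<subseteq> range U" "C \<subseteq> \<Union>F"
      using U unfolding compactin_def by (metis (no_types, lifting) rangeE)
    then obtain J where J: "finite J" "F = U ` J"
      by (meson finite_subset_image)
    then obtain n where "J \<subseteq> {..<n}" using finite_nat_iff_bounded by auto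
    then have "C \<subseteq> (\<Union>i<n. U i)" using F J by blast
    then have "chop e f \<in> below (\<Union>i<n. U i)"
      using \<open>e > 0\<close> by (intro chop_below[OF f]) (auto simp: C_def)
    then have "I (chop e f) \<le> (\<Sum>i<n. content (U i))"
      using below_le_content content_UN_finite[of U n, OF U] by fastforce
    also have "\<dots> \<le> (\<Sum>i. content (U i))"
      using s content_nonneg by (intro sum_le_suminf) auto
    finally show "I f \<le> (\<Sum>i. content (U i)) + e * I (\<lambda>x. 1)"
      using I_le_chop[OF f, of e] by simp
  qed
  then show ?thesis
    using s content_nonneg by (simp add: suminf_ennreal2 ennreal_leI)
qed auto

section \<open>The outer measure and Caratheodory's condition\<close>

definition outer :: "'a set \<Rightarrow> ennreal" where
  "outer E = (INF U\<in>{U. openin X U \<and> E \<subseteq> U}. ennreal (content U))"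

lemma outer_open: "openin X U \<Longrightarrow> outer U = ennreal (content U)"
  unfolding outer_def
  by (rule antisym) (auto intro!: INF_lower INF_greatest ennreal_leI content_mono)

lemma outer_le: "\<lbrakk>openin X U; E \<subseteq> U\<rbrakk> \<Longrightarrow> outer E \<le> ennreal (content U)"
  unfolding outer_def by (auto intro!: INF_lower)

lemma outer_mono: "E \<subseteq> F \<Longrightarrow> outer E \<le> outer F"
  unfolding outer_def by (intro INF_superset_mono) auto

lemma outer_approx:
  assumes "E \<subseteq> topspace X" "e > 0"
  obtains U where "openin X U" "E \<subseteq> U" "ennreal (content U) \<le> outer E + ennreal e"
proof -
  have "outer E \<le> ennreal (content (topspace X))" using assms by (intro outer_le) auto
  then have "outer E \<noteq> Orderings.top" by (auto simp: top_unique)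
  then have "outer E < outer E + ennreal e"
    using \<open>e > 0\<close> by (cases "outer E") (auto simp: ennreal_less_iff simp flip: ennreal_plus)
  then obtain U where "openin X U" "E \<subseteq> U" "ennreal (content U) < outer E + ennreal e"
    unfolding outer_def INF_less_iff by auto
  then show ?thesis using that by (simp add: less_imp_le)
qed

lemma outer_UN:
  assumes "\<And>i::nat. E i \<subseteq> topspace X"
  shows "outer (\<Union>i. E i) \<le> (\<Sum>i. outer (E i))"
proof (rule ennreal_le_epsilon)
  fix e :: real assume "e > 0"
  have "\<exists>U. openin X U \<and> E i \<subseteq> U \<and> ennreal (content U) \<le> outer (E i) + ennreal (e * (1/2)^Suc i)" for i
  proof -
    have "e * (1/2)^Suc i > 0" using \<open>e > 0\<close> by simp
    then show ?thesis using outer_approx[OF assms] by metis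
  qed
  then obtain U where U: "\<And>i. openin X (U i)" "\<And>i. E i \<subseteq> U i"
      "\<And>i. ennreal (content (U i)) \<le> outer (E i) + ennreal (e * (1/2)^Suc i)"
    by metis
  have "outer (\<Union>i. E i) \<le> ennreal (content (\<Union>i. U i))"
    using U by (intro outer_le) auto
  also have "\<dots> \<le> (\<Sum>i. ennreal (content (U i)))" by (rule content_UN[OF U(1)])
  also have "\<dots> \<le> (\<Sum>i. outer (E i) + ennreal (e * (1/2)^Suc i))"
    using U by (intro suminf_le) auto
  also have "\<dots> = (\<Sum>i. outer (E i)) + (\<Sum>i. ennreal (e * (1/2)^Suc i))"
    by (rule suminf_add[symmetric]) auto
  also have "(\<Sum>i. ennreal (e * (1/2)^Suc i)) = ennreal e"
    using sums_mult[OF power_half_series, of e] \<open>e > 0\<close>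
    by (subst suminf_ennreal_eq[of _ e]) auto
  finally show "outer (\<Union>i. E i) \<le> (\<Sum>i. outer (E i)) + ennreal e" .
qed

lemma outer_Un:
  assumes "E \<subseteq> topspace X" "F \<subseteq> topspace X"
  shows "outer (E \<union> F) \<le> outer E + outer F"
proof -
  have e: "outer {} = 0" using outer_open[of "{}"] by (simp add: content_empty)
  have "outer (\<Union>i. binaryset E F i) \<le> (\<Sum>i. outer (binaryset E F i))"
    using assms by (intro outer_UN) (auto simp: binaryset_def)
  then show ?thesis
    by (simp add: UN_binaryset_eq suminf_binaryset_eq[of outer] e)
qed

lemma outer_measure_space_outer: "outer_measure_space (Pow (topspace X)) outer"
  unfolding outer_measure_space_def positive_def increasing_def countably_subadditive_def
  using outer_open[of "{}"] by (auto simp: content_empty intro!: outer_mono outer_UN)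

text \<open>Caratheodory's inequality for an open test set V. With f below V \<inter> U and C the
  set where f \<ge> e, the function \<open>chop e f\<close> and any g below V - C are never both
  nonzero at a point, so their sum is still below V; and V - U lies in V - C.\<close>

lemma content_split:
  assumes U: "openin X U" and V: "openin X V"
  shows "outer (V \<inter> U) + outer (V - U) \<le> ennreal (content V)"
proof -
  have "content (V \<inter> U) \<le> content V - d" if d: "outer (V - U) = ennreal d" for d
  proof (rule content_least, rule le_eps)
    fix f and e :: real
    assume f: "f \<in> below (V \<inter> U)" and "e > 0"
    define C where "C = {x \<in> topspace X. f x \<ge> e}"
    have "closedin X C" unfolding C_def using f by (intro closedin_ge) (simp add: below_def)
    have CU: "C \<subseteq> V \<inter> U" using f \<open>e > 0\<close> by (force simp: C_def below_def)
    have VC: "openin X (V - C)" using V \<open>closedin X C\<close> by blast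
    have "ennreal d \<le> ennreal (content (V - C))"
      using outer_le[OF VC, of "V - U"] CU d by auto
    then have dl: "d \<le> content (V - C)" by (simp add: content_nonneg)
    have "content (V - C) \<le> content V - I (chop e f)"
    proof (rule content_least)
      fix g assume g: "g \<in> below (V - C)"
      have cf: "chop e f \<in> below V" using CU \<open>e > 0\<close> by (intro chop_below[OF f]) (auto simp: C_def)
      have "chop e f x + g x \<le> 1" if "x \<in> topspace X" for x
      proof (cases "x \<in> C")
        case True
        then have "g x = 0" using g that by (auto simp: below_def)
        then show ?thesis using cf that by (auto simp: below_def)
      next
        case False
        then have "chop e f x = 0" using that by (auto simp: C_def chop_def)
        then show ?thesis using g that by (auto simp: below_def)
      qed
      then have "(\<lambda>x. chop e f x + g x) \<in> below V"
        using cf g by (auto simp: below_def intro!: continuous_intros)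
      then have "I (\<lambda>x. chop e f x + g x) \<le> content V" by (rule below_le_content)
      then show "I g \<le> content V - I (chop e f)"
        using cf g by (subst (asm) add) (auto simp: below_def)
    qed
    with dl I_le_chop[OF f, of e] show "I f \<le> content V - d + e * I (\<lambda>x. 1)" by simp
  qed
  moreover have "outer (V - U) \<le> ennreal (content V)" using V by (intro outer_le) auto
  then obtain d where "outer (V - U) = ennreal d" "d \<ge> 0"
    by (cases "outer (V - U)") (auto simp: top_unique)
  ultimately show ?thesis
    using U V content_nonneg
    by (simp add: outer_open openin_Int flip: ennreal_plus) (smt (verit) ennreal_leI)
qed

text \<open>Since \<open>outer E\<close> is an infimum over the open supersets of E, the open test
  sets of \<open>content_split\<close> suffice.\<close>

lemma open_lambda_system:
  assumes U: "openin X U"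
  shows "U \<in> lambda_system (topspace X) (Pow (topspace X)) outer"
proof -
  interpret sigma_algebra "topspace X" "Pow (topspace X)" by (rule sigma_algebra_Pow)
  have "outer (E \<inter> U) + outer (E - U) = outer E" if E: "E \<subseteq> topspace X" for E
  proof (rule antisym)
    show "outer (E \<inter> U) + outer (E - U) \<le> outer E"
      unfolding outer_def[of E]
    proof (rule INF_greatest, safe)
      fix V assume V: "openin X V" "E \<subseteq> V"
      have "outer (E \<inter> U) + outer (E - U) \<le> outer (V \<inter> U) + outer (V - U)"
        using V by (intro add_mono outer_mono) auto
      then show "outer (E \<inter> U) + outer (E - U) \<le> ennreal (content V)"
        using content_split[OF U V(1)] by (rule order_trans)
    qed
    show "outer E \<le> outer (E \<inter> U) + outer (E - U)"
      using outer_Un[of "E \<inter> U" "E - U"] E by (simp add: Int_Diff_Un) (meson Diff_subset inf.coboundedI1 order_trans)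
  qed
  then show ?thesis using U by (auto simp: lambda_system_eq openin_subset)
qed

section \<open>The representing measure and its integral\<close>

definition riesz :: "'a measure" where
  "riesz = measure_of (topspace X) {U. openin X U} outer"

lemma opens_Pow: "{U. openin X U} \<subseteq> Pow (topspace X)"
  using openin_subset by auto

lemma riesz_borel: "borel_measure_on X riesz"
  using opens_Pow by (simp add: borel_measure_on_def riesz_def space_measure_of sets_measure_of)

text \<open>\<open>measure_of\<close> returns the given set function only where it is known to be a
  measure. Caratheodory's lemma provides this on the lambda system, which contains the open sets and
  hence the sigma-algebra that they generate.\<close>

lemma emeasure_riesz:
  assumes "B \<in> sets riesz"
  shows "emeasure riesz B = outer B"
proof -
  interpret P: sigma_algebra "topspace X" "Pow (topspace X)" by (rule sigma_algebra_Pow)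
  let ?L = "lambda_system (topspace X) (Pow (topspace X)) outer"
  have L: "measure_space (topspace X) ?L outer"
    by (rule P.caratheodory_lemma[OF outer_measure_space_outer])
  then interpret L: sigma_algebra "topspace X" ?L by (simp add: measure_space_def)
  have sub: "sigma_sets (topspace X) {U. openin X U} \<subseteq> ?L"
    by (rule L.sigma_sets_subset) (auto intro: open_lambda_system)
  have "measure_space (topspace X) (sigma_sets (topspace X) {U. openin X U}) outer"
    using L sub opens_Pow by (intro measure_down[OF L]) (auto intro: sigma_algebra_sigma_sets)
  then show ?thesis
    using assms riesz_borel opens_Pow unfolding measure_space_def
    by (intro emeasure_measure_of[OF riesz_def]) (auto simp: borel_measure_on_def)
qed

lemma emeasure_riesz_open: "openin X U \<Longrightarrow> emeasure riesz U = ennreal (content U)"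
  using riesz_borel by (simp add: emeasure_riesz outer_open borel_measure_on_open)

lemma finite_riesz: "finite_measure riesz"
  using riesz_borel emeasure_riesz_open[of "topspace X"]
  by (intro finite_measureI) (auto simp: borel_measure_on_def)

lemma measure_riesz_open: "openin X U \<Longrightarrow> measure riesz U = content U"
  by (simp add: measure_def emeasure_riesz_open content_nonneg)

lemma riesz_integrable: "cont f \<Longrightarrow> integrable riesz f"
  by (rule borel_measure_on_integrable[OF riesz_borel finite_riesz compact])

text \<open>\<open>min 1 (max 0 (t - real j))\<close> is the part of t between the heights j and j +
  1.\<close>

lemma sum_layers:
  fixes t :: real
  assumes "t \<ge> 0"
  shows "(\<Sum>j<n. min 1 (max 0 (t - real j))) = min (real n) t"
  by (induction n) (use assms in \<open>auto simp: min_def max_def\<close>)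

lemma I_sum:
  assumes "finite J" "\<And>j. j \<in> J \<Longrightarrow> cont (f j)"
  shows "I (\<lambda>x. \<Sum>j\<in>J. f j x) = (\<Sum>j\<in>J. I (f j))"
  using assms by (induction J) (auto simp: I_zero add continuous_map_sum)

lemma I_cong:
  assumes "cont f" "cont g" "\<And>x. x \<in> topspace X \<Longrightarrow> f x = g x"
  shows "I f = I g"
  using mono[of f g] mono[of g f] assms by fastforce

text \<open>Cut \<open>f\<close> into \<open>n\<close> layers of height \<open>1/n\<close>. On each layer \<open>I\<close> and the integral lie between the
  measures of two consecutive superlevel sets, so the errors telescope.\<close>

lemma riesz_integral_unit:
  assumes f: "cont f" and f01: "\<And>x. x \<in> topspace X \<Longrightarrow> 0 \<le> f x \<and> f x \<le> 1"
  shows "(LINT x|riesz. f x) = I f"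
proof -
  interpret finite_measure riesz by (rule finite_riesz)
  have sp: "space riesz = topspace X" using riesz_borel by (simp add: borel_measure_on_def)
  \<comment> \<open>The bound does not depend on n, so the error itself must vanish.\<close>
  have est: "real n * \<bar>I f - (LINT x|riesz. f x)\<bar> \<le> I (\<lambda>x. 1)" for n
  proof -
    define g where "g = (\<lambda>j x. min 1 (max 0 (real n * f x - real j)))"
    define U where "U = (\<lambda>j. {x \<in> topspace X. real n * f x > real j})"
    have Uo: "openin X (U j)" for j
      unfolding U_def by (rule openin_gt) (use f in \<open>auto intro!: continuous_intros\<close>)
    have gc: "cont (g j)" for j
      unfolding g_def using f by (intro continuous_intros) auto
    have gb: "g j \<in> below (U j)" for j
      using gc by (auto simp: below_def g_def U_def)
    have g1: "g j x = 1" if "x \<in> U (Suc j)" for j x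
      using that by (auto simp: g_def U_def)
    have sum: "(\<Sum>j<n. g j x) = real n * f x" if "x \<in> topspace X" for x
    proof -
      have "real n * f x \<le> real n" using f01[OF that] by (simp add: mult_left_le)
      then show ?thesis
        using f01[OF that] sum_layers[of "real n * f x" n] by (simp add: g_def min_absorb2)
    qed
    have "\<bar>I (g j) - (LINT x|riesz. g j x)\<bar> \<le> content (U j) - content (U (Suc j))" for j
    proof -
      have "I (g j) \<le> content (U j)" by (rule below_le_content[OF gb])
      moreover have "content (U (Suc j)) \<le> I (g j)"
      proof (rule content_least)
        fix h assume h: "h \<in> below (U (Suc j))"
        \<comment> \<open>h is at most 1 and lives on \<open>U (Suc j)\<close>, and there
          \<open>g j\<close> has already reached 1.\<close>
        have "h x \<le> g j x" if "x \<in> topspace X" for x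
          using that h gb[of j] g1[of x j] by (cases "x \<in> U (Suc j)") (auto simp: below_def)
        then show "I h \<le> I (g j)" using h gc by (intro mono) (auto simp: below_def)
      qed
      moreover have "(LINT x|riesz. g j x) \<le> (LINT x|riesz. indicator (U j) x)"
        using gb[of j] Uo[of j] riesz_borel
        by (intro integral_mono riesz_integrable gc integrable_real_indicator)
           (auto simp: below_def sp indicator_def borel_measure_on_open less_top[symmetric])
      moreover have "(LINT x|riesz. indicator (U (Suc j)) x) \<le> (LINT x|riesz. g j x)"
        using gb[of j] g1[of _ j] Uo[of "Suc j"] riesz_borel
        by (intro integral_mono riesz_integrable gc integrable_real_indicator)
           (auto simp: below_def sp indicator_def borel_measure_on_open less_top[symmetric])
      moreover have k: "(LINT x|riesz. indicator (U k) x) = content (U k)" for k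
        using Uo[of k] by (simp add: measure_riesz_open sp Int_absorb2 openin_subset)
      ultimately show ?thesis using k[of j] k[of "Suc j"] by linarith
    qed
    then have "\<bar>\<Sum>j<n. I (g j) - (LINT x|riesz. g j x)\<bar> \<le> (\<Sum>j<n. content (U j) - content (U (Suc j)))"
      by (intro order_trans[OF sum_abs] sum_mono)
    also have "\<dots> = content (U 0) - content (U n)" by (rule sum_lessThan_telescope')
    also have "\<dots> \<le> I (\<lambda>x. 1)" using content_le[of "U 0"] content_nonneg[of "U n"] by linarith
    finally have "\<bar>\<Sum>j<n. I (g j) - (LINT x|riesz. g j x)\<bar> \<le> I (\<lambda>x. 1)"
      .
    moreover have "(\<Sum>j<n. I (g j)) = real n * I f"
      using gc f by (simp add: I_sum[symmetric] scale[symmetric])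
        (intro I_cong, auto intro!: continuous_intros simp: sum)
    moreover have "(\<Sum>j<n. LINT x|riesz. g j x) = real n * (LINT x|riesz. f x)"
      using gc by (subst Bochner_Integration.integral_sum[symmetric])
        (auto intro!: riesz_integrable Bochner_Integration.integral_cong simp: sum sp simp flip: integral_mult_right_zero)
    ultimately show ?thesis
      by (simp add: sum_subtractf abs_mult flip: right_diff_distrib)
  qed
  show ?thesis
  proof (rule ccontr)
    assume "\<not> ?thesis"
    then have "\<bar>I f - (LINT x|riesz. f x)\<bar> > 0" by simp
    then obtain n where "I (\<lambda>x. 1) < real n * \<bar>I f - (LINT x|riesz. f x)\<bar>"
      using ex_less_of_nat_mult by blast
    with est[of n] show False by simp
  qed
qed

theorem riesz_integral:
  assumes f: "cont f"
  shows "(LINT x|riesz. f x) = I f"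
proof -
  interpret finite_measure riesz by (rule finite_riesz)
  obtain B where B: "B > 0" "\<And>x. x \<in> topspace X \<Longrightarrow> \<bar>f x\<bar> \<le> B"
    using compact_space_real_bounded[OF compact f] by blast
  \<comment> \<open>Affine change of scale from [-B, B] to [0, 1]; the added constant is accounted
    for by the total mass.\<close>
  define g where "g = (\<lambda>x. 1 / (2 * B) * (f x + B * 1))"
  have "0 \<le> g x \<and> g x \<le> 1" if "x \<in> topspace X" for x
    using B(1) B(2)[OF that] by (auto simp: g_def field_simps abs_le_iff)
  moreover have gc: "cont g" unfolding g_def using f by (intro continuous_intros) auto
  ultimately have "(LINT x|riesz. g x) = I g" by (intro riesz_integral_unit)
  moreover have "I g = 1 / (2 * B) * (I f + B * I (\<lambda>x. 1))"
    unfolding g_def using f by (subst scale, force intro!: continuous_intros, subst add)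
      (auto intro!: continuous_intros simp: scale[of "\<lambda>x. 1" B, simplified])
  moreover have "(LINT x|riesz. g x) = 1 / (2 * B) * ((LINT x|riesz. f x) + B * (LINT x|riesz. 1))"
    using riesz_integrable[OF f] by (simp add: g_def)
  moreover have "(LINT x|riesz. 1) = I (\<lambda>x. 1)"
    by (intro riesz_integral_unit) auto
  ultimately show ?thesis using B(1) by (simp add: field_simps)
qed

section \<open>Regularity of the measure and invariance under homeomorphisms\<close>

lemma riesz_outer_regular:
  assumes "B \<in> sets riesz"
  shows "emeasure riesz B = (INF U\<in>{U. openin X U \<and> B \<subseteq> U}. emeasure riesz U)"
  using assms by (auto simp: emeasure_riesz[of B] outer_def emeasure_riesz_open intro!: INF_cong)

text \<open>The compact sets C where f \<ge> e exhaust U in measure: \<open>chop e f\<close> is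
  below every open superset of C, so \<open>I (chop e f)\<close> is at most
  \<open>outer C\<close>.\<close>

lemma riesz_inner_regular:
  assumes U: "openin X U"
  shows "emeasure riesz U = (SUP C\<in>{C. compactin X C \<and> C \<subseteq> U}. emeasure riesz C)"
proof (rule antisym)
  let ?S = "SUP C\<in>{C. compactin X C \<and> C \<subseteq> U}. emeasure riesz C"
  have Us: "U \<in> sets riesz" using riesz_borel U by (rule borel_measure_on_open)
  show S: "?S \<le> emeasure riesz U"
    using Us by (intro SUP_least emeasure_mono) auto
  then obtain s where s: "?S = ennreal s" "s \<ge> 0"
    by (cases ?S) (auto simp: top_unique emeasure_riesz_open[OF U])
  have "content U \<le> s"
  proof (rule content_least, rule le_eps)
    fix f and e :: real
    assume f: "f \<in> below U" and "e > 0"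
    define C where "C = {x \<in> topspace X. f x \<ge> e}"
    have Cc: "closedin X C" unfolding C_def using f by (intro closedin_ge) (simp add: below_def)
    have CU: "C \<subseteq> U" using f \<open>e > 0\<close> by (force simp: C_def below_def)
    have "ennreal (I (chop e f)) \<le> outer C"
      unfolding outer_def using \<open>e > 0\<close>
      by (intro INF_greatest ennreal_leI below_le_content chop_below[OF f]) (auto simp: C_def)
    also have "\<dots> = emeasure riesz C"
      using emeasure_riesz borel_measure_on_closed[OF riesz_borel Cc] by simp
    also have "\<dots> \<le> ?S"
      using Cc CU compact by (intro SUP_upper) (auto simp: closedin_compact_space)
    finally have "I (chop e f) \<le> s" using s by simp
    with I_le_chop[OF f, of e] show "I f \<le> s + e * I (\<lambda>x. 1)" by simp
  qed
  then show "emeasure riesz U \<le> ?S"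
    using s U by (simp add: emeasure_riesz_open ennreal_leI)
qed

text \<open>Composition with h carries functions below the image of U to functions below U. The
  inverse k will give the opposite inequality.\<close>

lemma content_homeo_le:
  assumes hk: "homeomorphic_maps X X h k"
    and inv: "\<And>f. cont f \<Longrightarrow> I (f \<circ> h) = I f"
    and U: "openin X U"
  shows "content (h ` U) \<le> content U"
proof (rule content_least)
  fix f assume f: "f \<in> below (h ` U)"
  have hc: "continuous_map X X h" and kh: "\<And>x. x \<in> topspace X \<Longrightarrow> k (h x) = x"
    using hk by (auto simp: homeomorphic_maps_def)
  have fc: "cont f" using f by (simp add: below_def)
  have "f (h x) = 0" if "x \<in> topspace X - U" for x
  proof -
    have "h x \<notin> h ` U"
      using that kh openin_subset[OF U] by (metis DiffE image_iff subsetD)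
    then show ?thesis
      using f that hc by (auto simp: below_def continuous_map_def)
  qed
  moreover have "0 \<le> f (h x) \<and> f (h x) \<le> 1" if "x \<in> topspace X" for x
    using f that hc by (auto simp: below_def continuous_map_def)
  ultimately have "f \<circ> h \<in> below U"
    using continuous_map_compose[OF hc fc] unfolding below_def mem_Collect_eq o_def by blast
  then show "I f \<le> content U"
    using below_le_content[of "f \<circ> h" U] inv[OF fc] by simp
qed

text \<open>The measure of B depends only on its open supersets, and the images of these under h are
  exactly the open supersets of the image of B. Measurability of that image comes from writing it as
  a preimage under k.\<close>

lemma emeasure_riesz_homeo:
  assumes hk: "homeomorphic_maps X X h k"
    and inv: "\<And>f. cont f \<Longrightarrow> I (f \<circ> h) = I f"
    and B: "B \<in> sets riesz"
  shows "emeasure riesz (h ` B) = emeasure riesz B"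
proof -
  have kh: "homeomorphic_maps X X k h"
    using hk homeomorphic_maps_sym by blast
  have hc: "continuous_map X X h" and kc: "continuous_map X X k"
    and kh_id: "\<And>x. x \<in> topspace X \<Longrightarrow> k (h x) = x" and hk_id: "\<And>x. x \<in> topspace X \<Longrightarrow> h (k x) = x"
    using hk by (auto simp: homeomorphic_maps_def)
  have hX: "\<And>x. x \<in> topspace X \<Longrightarrow> h x \<in> topspace X" and kX: "\<And>x. x \<in> topspace X \<Longrightarrow> k x \<in> topspace X"
    using hc kc by (auto simp: continuous_map_def)
  have inv': "I (f \<circ> k) = I f" if "cont f" for f
  proof -
    \<comment> \<open>The invariance is applied to f \<circ> k; composing with h gives back f only
      on \<open>topspace X\<close>, whence \<open>I_cong\<close>.\<close>
    have "I (f \<circ> k) = I ((f \<circ> k) \<circ> h)"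
      using inv[OF continuous_map_compose[OF kc that]] by simp
    also have "\<dots> = I f"
      using that kc hc by (intro I_cong continuous_map_compose) (auto simp: kh_id)
    finally show ?thesis .
  qed
  have him: "h ` V = {x \<in> topspace X. k x \<in> V}" if "V \<subseteq> topspace X" for V
    using that hX kh_id hk_id by (force simp: image_iff)
  have kim: "k ` V = {x \<in> topspace X. h x \<in> V}" if "V \<subseteq> topspace X" for V
    using that kX kh_id hk_id by (force simp: image_iff)
  have ho: "openin X (h ` V)" if "openin X V" for V
    using openin_continuous_map_preimage[OF kc that] him[OF openin_subset[OF that]] by simp
  have ko: "openin X (k ` V)" if "openin X V" for V
    using openin_continuous_map_preimage[OF hc that] kim[OF openin_subset[OF that]] by simp
  have hkV: "h ` k ` V = V" if "V \<subseteq> topspace X" for V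
    using that hk_id by (force simp: image_iff)
  have khV: "k ` h ` V = V" if "V \<subseteq> topspace X" for V
    using that kh_id by (force simp: image_iff)
  have content_eq: "content (h ` V) = content V" if "openin X V" for V
    using content_homeo_le[OF hk inv that] content_homeo_le[OF kh inv' ho[OF that]]
      khV[OF openin_subset[OF that]] by simp
  have BX: "B \<subseteq> topspace X"
    using sets.sets_into_space[OF B] riesz_borel by (simp add: borel_measure_on_def)
  have im: "{U. openin X U \<and> h ` B \<subseteq> U} = (`) h ` {V. openin X V \<and> B \<subseteq> V}"
  proof safe
    fix U assume U: "openin X U" "h ` B \<subseteq> U"
    then have "U = h ` (k ` U)" "B \<subseteq> k ` U"
      using hkV[OF openin_subset] khV[OF BX] image_mono[of "h ` B" U k] by auto
    then show "U \<in> (`) h ` {V. openin X V \<and> B \<subseteq> V}"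
      using ko[OF U(1)] by blast
  qed (auto intro: ho)
  have "k \<in> measurable riesz riesz"
  proof (rule measurable_sigma_sets)
    show "sets riesz = sigma_sets (topspace X) {U. openin X U}"
      using riesz_borel by (simp add: borel_measure_on_def)
    show "k \<in> space riesz \<rightarrow> topspace X"
      using riesz_borel kX by (auto simp: borel_measure_on_def)
    show "k -` V \<inter> space riesz \<in> sets riesz" if "V \<in> {U. openin X U}" for V
    proof -
      have "k -` V \<inter> space riesz = h ` V"
        using that riesz_borel him[of V] openin_subset[of X V] by (auto simp: borel_measure_on_def)
      then show ?thesis
        using borel_measure_on_open[OF riesz_borel ho] that by simp
    qed
  qed (rule opens_Pow)
  then have "k -` B \<inter> space riesz \<in> sets riesz"
    using B by (rule measurable_sets)
  moreover have "k -` B \<inter> space riesz = h ` B"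
    using him[OF BX] riesz_borel by (auto simp: borel_measure_on_def)
  ultimately have "h ` B \<in> sets riesz" by simp
  moreover have "outer (h ` B) = outer B"
    unfolding outer_def im image_image by (intro INF_cong) (auto simp: content_eq)
  ultimately show ?thesis using B by (simp add: emeasure_riesz)
qed

end

section \<open>Separable compact commutative semigroups\<close>

text \<open>A compact Hausdorff space carries the initial topology of its continuous real functions.
  The tolerance 1 suffices, because Urysohn's lemma provides a function that is 0 at f z and 1 off
  U.\<close>

lemma continuous_map_into_compact_Hausdorff:
  assumes X: "compact_space X" "Hausdorff_space X"
    and f: "\<And>z. z \<in> topspace Z \<Longrightarrow> f z \<in> topspace X"
    and sep: "\<And>F z. \<lbrakk>continuous_map X euclideanreal F; z \<in> topspace Z\<rbrakk>
      \<Longrightarrow> \<exists>V. openin Z V \<and> z \<in> V \<and> (\<forall>z'\<in>V. \<bar>F (f z') - F (f z)\<bar> < 1)"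
  shows "continuous_map Z X f"
proof -
  have "openin Z {z \<in> topspace Z. f z \<in> U}" if U: "openin X U" for U
  proof (subst openin_subopen, safe)
    fix z assume z: "z \<in> topspace Z" "f z \<in> U"
    have "normal_space X"
      using X by (simp add: compact_Hausdorff_or_regular_imp_normal_space)
    then obtain F where F: "continuous_map X euclideanreal F" "F ` {f z} \<subseteq> {0}" "F ` (topspace X - U) \<subseteq> {1}"
      using U z f X by (elim Urysohn_lemma_alt[of X "{f z}" "topspace X - U" 0 1])
        (auto simp: disjnt_def closedin_Hausdorff_sing_eq)
    obtain V where V: "openin Z V" "z \<in> V" "\<forall>z'\<in>V. \<bar>F (f z') - F (f z)\<bar> < 1"
      using sep[OF F(1) z(1)] by blast
    have "V \<subseteq> {z \<in> topspace Z. f z \<in> U}"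
    proof safe
      fix z' assume z': "z' \<in> V"
      then show "z' \<in> topspace Z" using V(1) openin_subset by blast
      then have fz': "f z' \<in> topspace X" by (rule f)
      show "f z' \<in> U"
      proof (rule ccontr)
        assume "f z' \<notin> U"
        then have "F (f z') = 1" using fz' F(3) by blast
        moreover have "F (f z) = 0" using F(2) by auto
        moreover have "\<bar>F (f z') - F (f z)\<bar> < 1" using V(3) z' by blast
        ultimately show False by simp
      qed
    qed
    then show "\<exists>T. openin Z T \<and> z \<in> T \<and> T \<subseteq> {z \<in> topspace Z. f z \<in> U}"
      using V by blast
  qed
  then show ?thesis using f by (auto simp: continuous_map_def)
qed

text \<open>The product is only separately continuous, and no identity is assumed; joint continuity
  is proved later, for the kernel.\<close>

locale separable_compact_semigroup =
  fixes X :: "'a topology" and mul :: "'a \<Rightarrow> 'a \<Rightarrow> 'a" (infixl "\<cdot>" 70) and d :: "nat \<Rightarrow> 'a"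
  assumes compact: "compact_space X" and Hausdorff: "Hausdorff_space X"
    and closed [simp]: "\<lbrakk>x \<in> topspace X; y \<in> topspace X\<rbrakk> \<Longrightarrow> x \<cdot> y \<in> topspace X"
    and assoc: "\<lbrakk>x \<in> topspace X; y \<in> topspace X; z \<in> topspace X\<rbrakk> \<Longrightarrow> x \<cdot> y \<cdot> z = x \<cdot> (y \<cdot> z)"
    and comm: "\<lbrakk>x \<in> topspace X; y \<in> topspace X\<rbrakk> \<Longrightarrow> x \<cdot> y = y \<cdot> x"
    and cont_left: "x \<in> topspace X \<Longrightarrow> continuous_map X X (\<lambda>y. x \<cdot> y)"
    and d_in [simp]: "d n \<in> topspace X"
    and d_dense: "X closure_of range d = topspace X"
begin

abbreviation S :: "'a set" where "S \<equiv> topspace X"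

abbreviation cont :: "('a \<Rightarrow> real) \<Rightarrow> bool" where
  "cont \<equiv> continuous_map X euclideanreal"

lemma cont_translate: "\<lbrakk>cont F; x \<in> S\<rbrakk> \<Longrightarrow> cont (\<lambda>y. F (x \<cdot> y))"
  using continuous_map_compose[OF cont_left, of x euclideanreal F] by (simp add: o_def)

lemma cont_translate_right: "\<lbrakk>cont F; x \<in> S\<rbrakk> \<Longrightarrow> cont (\<lambda>y. F (y \<cdot> x))"
  by (rule continuous_map_eq[OF cont_translate[of F x]]) (auto simp: comm)

section \<open>Control of a continuous function by a dense sequence\<close>

lemma cont_eq_on_dense:
  assumes "cont F" "cont G" "\<And>n. F (d n) = G (d n)" "x \<in> S"
  shows "F x = G x"
proof -
  have "closedin X {x \<in> S. F x - G x \<in> {0}}"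
    using assms by (intro closedin_continuous_map_preimage[where Y = euclideanreal] continuous_intros) auto
  then have "X closure_of range d \<subseteq> {x \<in> S. F x - G x \<in> {0}}"
    using assms by (intro closure_of_minimal) auto
  then show ?thesis using assms(4) d_dense by auto
qed

text \<open>Up to \<open>\<epsilon>\<close>, the function \<open>y \<mapsto> F (r \<cdot> y)\<close> depends only on finitely many of the values
  \<open>F (d n \<cdot> y)\<close>. This replaces the passage to a metrizable quotient.\<close>

lemma finitely_determined:
  assumes F: "cont F" and r: "r \<in> S" and "e > 0"
  shows "\<exists>k. \<forall>y\<in>S. \<forall>y'\<in>S. (\<forall>n\<le>k. \<bar>F (d n \<cdot> y) - F (d n \<cdot> y')\<bar> \<le> 1 / (real k + 1)) \<longrightarrow> \<bar>F (r \<cdot> y) - F (r \<cdot> y')\<bar> < e"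
proof (rule ccontr)
  assume neg: "\<not> ?thesis"
  define P where "P = prod_topology X X"
  define g where "g = (\<lambda>x p. F (x \<cdot> fst p) - F (x \<cdot> snd p))"
  \<comment> \<open>\<open>C k\<close> collects the pairs that refute the index k. Tying the number
    of tests and the tolerance to the same k makes these closed sets decrease. A common point would
    satisfy \<open>F (d n \<cdot> y) = F (d n \<cdot> y')\<close> for all n, and density then
    contradicts the gap e.\<close>
  define C where "C k = (\<Inter>n\<le>k. {p \<in> topspace P. \<bar>g (d n) p\<bar> \<in> {..1 / (real k + 1)}})
      \<inter> {p \<in> topspace P. \<bar>g r p\<bar> \<in> {e..}}" for k :: nat
  have gc: "continuous_map P euclideanreal (g x)" if "x \<in> S" for x
    unfolding g_def P_def
    using continuous_map_compose[OF continuous_map_fst cont_translate[OF F that], of X]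
      continuous_map_compose[OF continuous_map_snd cont_translate[OF F that], of X]
    by (intro continuous_map_diff) (auto simp: o_def)
  have "compact_space P" by (simp add: P_def compact_space_prod_topology compact)
  moreover have "closedin P (C k)" for k
    unfolding C_def using gc[of "d _"] gc[OF r]
    by (intro closedin_Int closedin_INT closedin_continuous_map_preimage[where Y = euclideanreal]
        continuous_map_real_abs) auto
  moreover have "C k \<noteq> {}" for k
  proof -
    obtain y y' where "y \<in> S" "y' \<in> S" "\<not> \<bar>F (r \<cdot> y) - F (r \<cdot> y')\<bar> < e"
      "\<forall>n\<le>k. \<bar>F (d n \<cdot> y) - F (d n \<cdot> y')\<bar> \<le> 1 / (real k + 1)"
      using neg by blast
    then have "(y, y') \<in> C k"
      by (simp add: C_def P_def g_def)
    then show ?thesis by blast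
  qed
  moreover have "antimono C"
  proof (rule antimonoI)
    fix m n :: nat assume "m \<le> n"
    then have le: "1 / (real n + 1) \<le> 1 / (real m + 1)" by (simp add: frac_le)
    show "C n \<subseteq> C m"
    proof
      fix p assume p: "p \<in> C n"
      have "\<bar>g (d i) p\<bar> \<le> 1 / (real m + 1)" if "i \<le> m" for i
        using p that \<open>m \<le> n\<close> by (intro order_trans[OF _ le]) (auto simp: C_def)
      then show "p \<in> C m" using p by (auto simp: C_def)
    qed
  qed
  ultimately have "\<Inter>(range C) \<noteq> {}" by (rule compact_space_imp_nest)
  then obtain y y' where p: "\<And>k. (y, y') \<in> C k" by auto
  then have yS: "y \<in> S" "y' \<in> S" by (auto simp: C_def P_def)
  have "F (d n \<cdot> y) = F (d n \<cdot> y')" for n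
  proof -
    have "\<bar>F (d n \<cdot> y) - F (d n \<cdot> y')\<bar> \<le> 0"
    proof (rule LIMSEQ_le_const[of "\<lambda>k. 1 / (real k + 1)"], goal_cases)
      case 1 then show ?case by real_asymp
    next
      case 2
      have "\<bar>F (d n \<cdot> y) - F (d n \<cdot> y')\<bar> \<le> 1 / (real k + 1)" if "n \<le> k" for k
        using p[of k] that by (auto simp: C_def g_def)
      then show ?case by blast
    qed
    then show ?thesis by simp
  qed
  then have "F (r \<cdot> y) = F (r \<cdot> y')"
    using cont_eq_on_dense[OF cont_translate_right[OF F yS(1)] cont_translate_right[OF F yS(2)] _ r] by blast
  moreover have "\<bar>F (r \<cdot> y) - F (r \<cdot> y')\<bar> \<ge> e" using p[of 0] by (auto simp: C_def g_def)
  ultimately show False using \<open>e > 0\<close> by simp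
qed

text \<open>Closure in a nonmetrizable space provides nets only. For a single F it is enough that q
  k matches m up to 1 / (k + 1) under the tests d 0, ..., d k: after swapping factors,
  \<open>finitely_determined\<close> with r = s turns this into convergence at every s, along one
  and the same sequence.\<close>

lemma dense_sequence:
  assumes F: "cont F" and m: "m \<in> S"
  obtains q where "range q \<subseteq> range d" "\<And>s. s \<in> S \<Longrightarrow> (\<lambda>k. F (q k \<cdot> s)) \<longlonglongrightarrow> F (m \<cdot> s)"
proof -
  have "\<exists>x\<in>range d. \<forall>n\<le>k. \<bar>F (d n \<cdot> x) - F (d n \<cdot> m)\<bar> < 1 / (real k + 1)" for k :: nat
  proof -
    let ?U = "\<Inter>n\<in>{..k}. {x \<in> S. \<bar>F (d n \<cdot> x) - F (d n \<cdot> m)\<bar> \<in> {..<1 / (real k + 1)}}"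
    have "openin X ?U"
      using F by (intro openin_INT2 openin_continuous_map_preimage[where Y = euclideanreal]
        continuous_intros cont_translate) auto
    moreover have "m \<in> ?U" using m by simp
    moreover have "m \<in> X closure_of range d" using m d_dense by simp
    ultimately obtain x where "x \<in> range d" "x \<in> ?U" unfolding in_closure_of by blast
    then show ?thesis by (intro bexI[of _ x]) auto
  qed
  then obtain q where q: "\<And>k. q k \<in> range d" "\<And>k n. n \<le> k \<Longrightarrow> \<bar>F (d n \<cdot> q k) - F (d n \<cdot> m)\<bar> < 1 / (real k + 1)"
    by metis
  have qS: "q k \<in> S" for k using q(1)[of k] by auto
  have "(\<lambda>k. F (q k \<cdot> s)) \<longlonglongrightarrow> F (m \<cdot> s)" if s: "s \<in> S" for s
  proof (rule LIMSEQ_I)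
    fix e :: real assume "e > 0"
    obtain k where k: "\<And>y y'. \<lbrakk>y \<in> S; y' \<in> S; \<forall>n\<le>k. \<bar>F (d n \<cdot> y) - F (d n \<cdot> y')\<bar> \<le> 1 / (real k + 1)\<rbrakk>
        \<Longrightarrow> \<bar>F (s \<cdot> y) - F (s \<cdot> y')\<bar> < e"
      using finitely_determined[OF F s \<open>e > 0\<close>] by blast
    have "norm (F (q j \<cdot> s) - F (m \<cdot> s)) < e" if "j \<ge> k" for j
    proof -
      have "1 / (real j + 1) \<le> 1 / (real k + 1)" using that by (simp add: frac_le)
      then have "\<bar>F (s \<cdot> q j) - F (s \<cdot> m)\<bar> < e"
        using q(2)[of _ j] that by (intro k qS m) (meson less_imp_le order_trans)
      then show ?thesis using s m qS by (simp add: comm)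
    qed
    then show "\<exists>no. \<forall>n\<ge>no. norm (F (q n \<cdot> s) - F (m \<cdot> s)) < e" by blast
  qed
  then show ?thesis using q that[of q] by blast
qed

section \<open>The kernel as an abstract group\<close>

definition kernel :: "'a set" where
  "kernel = (\<Inter>s\<in>S. (\<lambda>t. s \<cdot> t) ` S)"

lemma S_nonempty: "S \<noteq> {}" using d_in by blast

lemma closedin_translate: "s \<in> S \<Longrightarrow> closedin X ((\<lambda>t. s \<cdot> t) ` S)"
  using compactin_imp_closedin Hausdorff image_compactin cont_left compact
  unfolding compact_space_def by blast

lemma kernel_subset: "kernel \<subseteq> S"
proof
  fix x assume "x \<in> kernel"
  then have "x \<in> (\<lambda>t. d 0 \<cdot> t) ` S" using d_in[of 0] unfolding kernel_def by blast
  then show "x \<in> S" by auto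
qed

lemma kernel_S [simp]: "x \<in> kernel \<Longrightarrow> x \<in> S"
  using kernel_subset by blast

lemma closedin_kernel: "closedin X kernel"
  unfolding kernel_def using S_nonempty closedin_translate by (intro closedin_INT) auto

text \<open>The product of the elements of T and one further element is, by commutativity, a
  multiple of each element of T. This is the finite intersection property behind
  \<open>kernel_nonempty\<close>.\<close>

lemma finite_translates_meet:
  assumes "finite T" "T \<subseteq> S"
  shows "\<exists>x\<in>S. \<forall>s\<in>T. x \<in> (\<lambda>t. s \<cdot> t) ` S"
  using assms
proof (induction T)
  case empty
  then show ?case by (intro bexI[OF _ d_in[of 0]]) simp
next
  case (insert a T)
  then obtain x where x: "x \<in> S" "\<forall>s\<in>T. x \<in> (\<lambda>t. s \<cdot> t) ` S" by auto
  have "a \<cdot> x \<in> (\<lambda>t. s \<cdot> t) ` S" if s: "s \<in> T" for s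
  proof -
    obtain t where t: "t \<in> S" "x = s \<cdot> t" using x s by blast
    have "a \<cdot> x = s \<cdot> (a \<cdot> t)"
      using t s insert.prems by (metis assoc comm insert_subset subsetD)
    then show ?thesis using t insert.prems by auto
  qed
  then show ?case using x insert.prems by (intro bexI[of _ "a \<cdot> x"]) auto
qed

lemma kernel_nonempty: "kernel \<noteq> {}"
proof -
  define \<U> where "\<U> = (\<lambda>s. (\<lambda>t. s \<cdot> t) ` S) ` S"
  have "(\<forall>C\<in>\<U>. closedin X C) \<and> (\<forall>\<F>. finite \<F> \<and> \<F> \<subseteq> \<U> \<longrightarrow> \<Inter>\<F> \<noteq> {}) \<longrightarrow> \<Inter>\<U> \<noteq> {}"
    using compact unfolding compact_space_fip by (rule spec)
  moreover have "\<forall>C\<in>\<U>. closedin X C"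
    by (simp add: \<U>_def closedin_translate)
  moreover have "\<Inter>\<F> \<noteq> {}" if fin: "finite \<F>" "\<F> \<subseteq> \<U>" for \<F>
  proof -
    obtain T where T: "T \<subseteq> S" "finite T" "\<F> = (\<lambda>s. (\<lambda>t. s \<cdot> t) ` S) ` T"
      using finite_subset_image[OF fin[unfolded \<U>_def]] by (elim exE conjE)
    obtain x where "\<forall>s\<in>T. x \<in> (\<lambda>t. s \<cdot> t) ` S"
      using finite_translates_meet[OF T(2,1)] by (elim bexE)
    then have "x \<in> \<Inter>\<F>" unfolding T(3) INT_iff .
    then show ?thesis by (metis empty_iff)
  qed
  ultimately have "\<Inter>\<U> \<noteq> {}" by simp
  then show ?thesis unfolding kernel_def \<U>_def .
qed

lemma kernelE:
  assumes "k \<in> kernel" "t \<in> S"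
  obtains u where "u \<in> S" "k = t \<cdot> u"
proof -
  have "k \<in> (\<lambda>u. t \<cdot> u) ` S"
    using assms(1) unfolding kernel_def by (rule INT_D) (rule assms(2))
  then show ?thesis using that by (elim imageE)
qed

lemma kernel_ideal:
  assumes "s \<in> S" "k \<in> kernel" shows "s \<cdot> k \<in> kernel"
  unfolding kernel_def
proof
  fix t assume t: "t \<in> S"
  then obtain u where u: "u \<in> S" "k = t \<cdot> u" using kernelE assms(2) by blast
  then have "s \<cdot> k = t \<cdot> (s \<cdot> u)" using assms t by (metis assoc comm)
  then show "s \<cdot> k \<in> (\<lambda>t'. t \<cdot> t') ` S" using u assms by auto
qed

lemma kernel_closed [simp]: "\<lbrakk>x \<in> kernel; y \<in> kernel\<rbrakk> \<Longrightarrow> x \<cdot> y \<in> kernel"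
  using kernel_ideal by auto

lemma kernel_divisible:
  assumes "k \<in> kernel" "x \<in> kernel"
  obtains y where "y \<in> kernel" "x = k \<cdot> y"
proof -
  \<comment> \<open>Dividing by \<open>k \<cdot> k\<close> instead of k leaves one factor k in the
    quotient, which puts it into the kernel.\<close>
  have "k \<cdot> k \<in> S" using assms by simp
  then obtain u where "u \<in> S" "x = k \<cdot> k \<cdot> u" using kernelE assms(2) by blast
  then show ?thesis using assms that[of "u \<cdot> k"] kernel_ideal[of u k]
    by (metis assoc comm kernel_S)
qed

text \<open>\<open>one\<close> is written exactly as in \<open>kernel_group\<close>, so that the two
  structures coincide by unfolding.\<close>

definition kgroup :: "'a monoid" where
  "kgroup = \<lparr>carrier = kernel, mult = mul,
     one = (THE e. e \<in> kernel \<and> (\<forall>s\<in>kernel. e \<cdot> s = s \<and> s \<cdot> e = s))\<rparr>"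

text \<open>A solution e of k = k e for one k suffices: every s in the kernel is a multiple k y, so
  e s = k e y = s.\<close>

lemma kernel_identity: "\<one>\<^bsub>kgroup\<^esub> \<in> kernel \<and> (\<forall>s\<in>kernel. \<one>\<^bsub>kgroup\<^esub> \<cdot> s = s \<and> s \<cdot> \<one>\<^bsub>kgroup\<^esub> = s)"
proof -
  obtain k where k: "k \<in> kernel" using kernel_nonempty by blast
  obtain e where e: "e \<in> kernel" "k = k \<cdot> e" using kernel_divisible[OF k k] .
  have "e \<cdot> s = s \<and> s \<cdot> e = s" if s: "s \<in> kernel" for s
  proof -
    obtain y where y: "y \<in> kernel" "s = k \<cdot> y" using kernel_divisible[OF k s] .
    have "e \<cdot> s = (k \<cdot> e) \<cdot> y" using y k e by (metis assoc comm kernel_S)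
    then show ?thesis using e y s by (metis comm kernel_S)
  qed
  then have ex: "e \<in> kernel \<and> (\<forall>s\<in>kernel. e \<cdot> s = s \<and> s \<cdot> e = s)" using e by blast
  have "\<exists>!e. e \<in> kernel \<and> (\<forall>s\<in>kernel. e \<cdot> s = s \<and> s \<cdot> e = s)"
    using ex by metis
  from theI'[OF this] show ?thesis by (simp add: kgroup_def)
qed

lemma kgroup_simps [simp]: "carrier kgroup = kernel" "x \<otimes>\<^bsub>kgroup\<^esub> y = x \<cdot> y"
  by (simp_all add: kgroup_def)

lemma group_kgroup: "group kgroup"
proof (rule groupI)
  fix x assume "x \<in> carrier kgroup"
  then obtain y where "y \<in> kernel" "\<one>\<^bsub>kgroup\<^esub> = x \<cdot> y"
    using kernel_divisible[of x "\<one>\<^bsub>kgroup\<^esub>"] kernel_identity by auto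
  then show "\<exists>y\<in>carrier kgroup. y \<otimes>\<^bsub>kgroup\<^esub> x = \<one>\<^bsub>kgroup\<^esub>"
    using \<open>x \<in> carrier kgroup\<close> by (auto simp: comm intro!: bexI[of _ y])
qed (use kernel_identity in \<open>auto simp: assoc\<close>)

section \<open>Equicontinuity and the topological group structure of the kernel\<close>

definition Y :: "'a topology" where "Y = subtopology X kernel"

lemma topspace_Y [simp]: "topspace Y = kernel"
  using kernel_subset by (auto simp: Y_def)

lemma compact_Y: "compact_space Y"
  using closedin_kernel compact by (simp add: Y_def closedin_compact_space compact_space_subtopology)

lemma Hausdorff_Y: "Hausdorff_space Y"
  by (simp add: Y_def Hausdorff Hausdorff_space_subtopology)

lemma cont_Y: "cont F \<Longrightarrow> continuous_map Y euclideanreal F"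
  by (simp add: Y_def continuous_map_from_subtopology)

lemma cont_left_Y: "x \<in> kernel \<Longrightarrow> continuous_map Y Y (\<lambda>y. x \<cdot> y)"
  unfolding Y_def using cont_left[of x]
  by (auto simp: continuous_map_in_subtopology continuous_map_from_subtopology)

text \<open>Baire's theorem gives one precision k that serves all x in some nonempty open set.
  Compactness then leaves finitely many representatives p of the second variable, and the comparison
  of \<open>x \<cdot> y\<close> with \<open>x0 \<cdot> y\<close> runs through
  \<open>x \<cdot> p\<close> and \<open>x0 \<cdot> p\<close>, whence the factor 3.\<close>

lemma equicontinuous_at_some_point:
  assumes F: "cont F" and "e > 0"
  shows "\<exists>x0 V. openin Y V \<and> x0 \<in> V \<and> (\<forall>x\<in>V. \<forall>y\<in>kernel. \<bar>F (x \<cdot> y) - F (x0 \<cdot> y)\<bar> < 3 * e)"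
proof -
  define near where "near k y y' \<longleftrightarrow> (\<forall>n\<le>k. \<bar>F (d n \<cdot> y) - F (d n \<cdot> y')\<bar> \<le> 1 / (real k + 1))" for k :: nat and y y'
  \<comment> \<open>\<open>E k\<close> is closed because its conditions involve x only through the
    continuous maps x \<mapsto> F (x \<cdot> y). By \<open>finitely_determined\<close> these sets
    cover the kernel.\<close>
  define E where "E k = {x \<in> topspace Y. \<forall>y\<in>kernel. \<forall>y'\<in>kernel. near k y y' \<longrightarrow> \<bar>F (x \<cdot> y) - F (x \<cdot> y')\<bar> \<le> e}" for k
  have "closedin Y (E k)" for k
  proof -
    have "E k = topspace Y \<inter> (\<Inter>(y,y')\<in>{p \<in> kernel \<times> kernel. near k (fst p) (snd p)}. {x \<in> topspace Y. \<bar>F (x \<cdot> y) - F (x \<cdot> y')\<bar> \<in> {..e}})"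
      by (auto simp: E_def)
    also have "closedin Y \<dots>"
    proof (cases "{p \<in> kernel \<times> kernel. near k (fst p) (snd p)} = {}")
      case False
      then show ?thesis using F
        by (intro closedin_Int closedin_topspace closedin_INT)
          (auto intro!: closedin_continuous_map_preimage[where Y = euclideanreal, of Y _ "{.._}", simplified]
            continuous_intros cont_Y cont_translate_right)
    qed (simp only: closedin_topspace INT_empty Int_UNIV_right if_True)
    finally show ?thesis .
  qed
  moreover have "Y interior_of \<Union>(range E) \<noteq> {}"
  proof -
    have "\<exists>k. x \<in> E k" if "x \<in> kernel" for x
      using finitely_determined[OF F kernel_S[OF that] \<open>e > 0\<close>] that
      unfolding E_def near_def by (simp, meson kernel_S less_imp_le)
    then have "\<Union>(range E) = topspace Y" by (auto simp: E_def)
    then show ?thesis using kernel_nonempty interior_of_topspace[of Y] by simp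
  qed
  moreover have "locally_compact_space Y \<and> regular_space Y"
    using compact_Y Hausdorff_Y
    by (simp add: compact_Hausdorff_imp_regular_space compact_imp_locally_compact_space)
  ultimately have "\<exists>k. Y interior_of E k \<noteq> {}"
    using Baire_category_alt[of Y "range E"] countable_image[OF countableI_type, of E UNIV] by auto
  then obtain k x0 where x0: "x0 \<in> Y interior_of E k" by blast
  define U where "U = Y interior_of E k"
  have U: "openin Y U" "x0 \<in> U" "U \<subseteq> E k"
    using x0 by (simp_all add: U_def interior_of_subset)
  \<comment> \<open>Strict inequalities here, weak ones in \<open>near\<close>: \<open>W y\<close>
    is open, and its points are still near y.\<close>
  define W where "W y = {y' \<in> topspace Y. \<forall>n\<in>{..k}. \<bar>F (d n \<cdot> y') - F (d n \<cdot> y)\<bar> \<in> {..<1 / (real k + 1)}}" for y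
  have Wo: "openin Y (W y)" for y
  proof -
    have "W y = (\<Inter>n\<in>{..k}. {y' \<in> topspace Y. \<bar>F (d n \<cdot> y') - F (d n \<cdot> y)\<bar> \<in> {..<1 / (real k + 1)}})"
      by (auto simp: W_def)
    also have "openin Y \<dots>"
      using F by (intro openin_INT2 openin_continuous_map_preimage[where Y = euclideanreal]
        continuous_intros cont_Y cont_translate) auto
    finally show ?thesis .
  qed
  moreover have "(\<Union>y\<in>kernel. W y) = topspace Y" by (auto simp: W_def)
  ultimately obtain \<F> where "finite \<F>" "\<F> \<subseteq> W ` kernel" "\<Union>\<F> = topspace Y"
    using compact_Y unfolding compact_space by (metis (no_types, lifting) imageE)
  then obtain P where P: "finite P" "P \<subseteq> kernel" "(\<Union>y\<in>P. W y) = kernel"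
    by (metis finite_subset_image topspace_Y)
  define V where "V = U \<inter> (\<Inter>p\<in>P. {x \<in> topspace Y. \<bar>F (x \<cdot> p) - F (x0 \<cdot> p)\<bar> \<in> {..<e}})"
  have "P \<noteq> {}" using P(3) kernel_nonempty by auto
  then have "openin Y V"
    unfolding V_def using F U P
    by (intro openin_Int openin_INT2 openin_continuous_map_preimage[where Y = euclideanreal]
        continuous_intros cont_Y cont_translate_right) auto
  moreover have x0K: "x0 \<in> kernel" using U by (auto simp: E_def)
  then have "x0 \<in> V" using U \<open>e > 0\<close> by (simp add: V_def)
  moreover have "\<bar>F (x \<cdot> y) - F (x0 \<cdot> y)\<bar> < 3 * e" if x: "x \<in> V" and y: "y \<in> kernel" for x y
  proof -
    obtain p where p: "p \<in> P" "y \<in> W p" using P(3) y by blast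
    then have near: "near k y p"
      by (auto simp: W_def near_def less_imp_le)
    have E: "\<bar>F (z \<cdot> y) - F (z \<cdot> p)\<bar> \<le> e" if "z \<in> E k" for z
      using that y near p(1) P(2) unfolding E_def by blast
    have "x \<in> E k" "x0 \<in> E k" using x U by (auto simp: V_def)
    moreover have "\<bar>F (x \<cdot> p) - F (x0 \<cdot> p)\<bar> < e"
      using x p(1) by (simp add: V_def)
    ultimately show ?thesis using E[of x] E[of x0] by linarith
  qed
  ultimately show ?thesis by (intro exI[of _ x0] exI[of _ V]) simp
qed

text \<open>Homogeneity: with v inverse to w and x0 = x1 w one has x y = (w x) (v y) and x1 y = x0
  (v y). Pulling V back along w moves the estimate from x0 to x1, and uniformity in y absorbs the
  change from y to v y.\<close>

lemma equicontinuous: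
  assumes F: "cont F" and "e > 0" and x1: "x1 \<in> kernel"
  obtains V where "openin Y V" "x1 \<in> V" "\<And>x y. \<lbrakk>x \<in> V; y \<in> kernel\<rbrakk> \<Longrightarrow> \<bar>F (x \<cdot> y) - F (x1 \<cdot> y)\<bar> < e"
proof -
  interpret G: group kgroup by (rule group_kgroup)
  obtain x0 V where V: "openin Y V" "x0 \<in> V"
      "\<And>x y. \<lbrakk>x \<in> V; y \<in> kernel\<rbrakk> \<Longrightarrow> \<bar>F (x \<cdot> y) - F (x0 \<cdot> y)\<bar> < e"
    using equicontinuous_at_some_point[OF F, of "e / 3"] \<open>e > 0\<close> by auto
  have x0: "x0 \<in> kernel" using V openin_subset by fastforce
  obtain w where w: "w \<in> kernel" "x0 = x1 \<cdot> w" by (rule kernel_divisible[OF x1 x0])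
  obtain v where v: "v \<in> kernel" "x1 = x0 \<cdot> v" by (rule kernel_divisible[OF x0 x1])
  have wv: "w \<cdot> v = \<one>\<^bsub>kgroup\<^esub>"
    using w v x1 x0 G.r_cancel_one[of x1 "w \<cdot> v"]
    by (metis G.l_cancel_one G.m_closed assoc kernel_S kgroup_simps)
  define V1 where "V1 = {x \<in> topspace Y. w \<cdot> x \<in> V}"
  show ?thesis
  proof (rule that[of V1])
    show "openin Y V1" unfolding V1_def
      using V(1) cont_left_Y[OF w(1)] by (rule openin_continuous_map_preimage[rotated])
    show "x1 \<in> V1" using V w x1 by (auto simp: V1_def comm)
    fix x y assume x: "x \<in> V1" and y: "y \<in> kernel"
    have xK: "x \<in> kernel" using x by (simp add: V1_def)
    have "x = w \<cdot> v \<cdot> x" using wv xK kernel_identity by simp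
    then have "x \<cdot> y = (w \<cdot> x) \<cdot> (v \<cdot> y)"
      using w(1) v(1) xK y by (metis assoc comm closed kernel_S)
    moreover have "x1 \<cdot> y = x0 \<cdot> (v \<cdot> y)" using v x0 y by (metis assoc kernel_S)
    ultimately show "\<bar>F (x \<cdot> y) - F (x1 \<cdot> y)\<bar> < e"
      using V(3)[of "w \<cdot> x" "v \<cdot> y"] x y v by (simp add: V1_def)
  qed
qed

text \<open>The tests d n lie in S and not necessarily in the kernel, so the estimates above concern
  functions on all of S. The retraction of S onto the kernel given by its identity extends functions
  from the kernel to S.\<close>

lemma cont_extend: "continuous_map Y euclideanreal F \<Longrightarrow> cont (\<lambda>x. F (\<one>\<^bsub>kgroup\<^esub> \<cdot> x))"
proof -
  let ?e = "\<one>\<^bsub>kgroup\<^esub>"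
  assume F: "continuous_map Y euclideanreal F"
  have e: "?e \<in> kernel" using kernel_identity by blast
  have "?e \<cdot> x \<in> kernel" if "x \<in> S" for x using kernel_ideal[OF that e] that e by (simp add: comm)
  then have "continuous_map X Y (\<lambda>x. ?e \<cdot> x)"
    using cont_left[of ?e] e by (auto simp: Y_def continuous_map_in_subtopology)
  then show ?thesis using continuous_map_compose[OF _ F] by (force simp: o_def)
qed

lemma equicontinuous_Y:
  assumes F: "continuous_map Y euclideanreal F" and "e > 0" and x1: "x1 \<in> kernel"
  obtains V where "openin Y V" "x1 \<in> V" "\<And>x y. \<lbrakk>x \<in> V; y \<in> kernel\<rbrakk> \<Longrightarrow> \<bar>F (x \<cdot> y) - F (x1 \<cdot> y)\<bar> < e"
proof -
  obtain V where V: "openin Y V" "x1 \<in> V"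
    "\<And>x y. \<lbrakk>x \<in> V; y \<in> kernel\<rbrakk> \<Longrightarrow> \<bar>F (\<one>\<^bsub>kgroup\<^esub> \<cdot> (x \<cdot> y)) - F (\<one>\<^bsub>kgroup\<^esub> \<cdot> (x1 \<cdot> y))\<bar> < e"
    using equicontinuous[OF cont_extend[OF F] assms(2,3)] by blast
  have "V \<subseteq> kernel" using openin_subset[OF V(1)] by simp
  then show ?thesis using V x1 kernel_identity by (intro that[of V]) (auto simp: subset_iff)
qed

theorem compact_topological_group_kernel: "compact_topological_group kgroup Y"
proof -
  interpret G: group kgroup by (rule group_kgroup)
  have "continuous_map (prod_topology Y Y) Y (\<lambda>(x, y). x \<otimes>\<^bsub>kgroup\<^esub> y)"
  proof (rule continuous_map_into_compact_Hausdorff[OF compact_Y Hausdorff_Y])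
    fix F z assume F: "continuous_map Y euclideanreal F" and "z \<in> topspace (prod_topology Y Y)"
    then obtain x y where z: "z = (x, y)" "x \<in> kernel" "y \<in> kernel" by auto
    obtain V where V: "openin Y V" "x \<in> V"
        "\<And>x' y. \<lbrakk>x' \<in> V; y \<in> kernel\<rbrakk> \<Longrightarrow> \<bar>F (x' \<cdot> y) - F (x \<cdot> y)\<bar> < 1 / 2"
      using equicontinuous_Y[OF F _ z(2), of "1/2"] by auto
    define W where "W = {y' \<in> topspace Y. \<bar>F (x \<cdot> y') - F (x \<cdot> y)\<bar> \<in> {..<1/2}}"
    have "continuous_map Y euclideanreal (\<lambda>y'. F (x \<cdot> y'))"
      using continuous_map_compose[OF cont_left_Y[OF z(2)] F] by (simp add: o_def)
    then have "openin Y W" unfolding W_def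
      by (intro openin_continuous_map_preimage[where Y = euclideanreal] continuous_intros) auto
    then have "openin (prod_topology Y Y) (V \<times> W)"
      using V(1) by (simp add: openin_prod_Times_iff)
    moreover have "z \<in> V \<times> W" using z V by (simp add: W_def)
    \<comment> \<open>The comparison passes through \<open>F (x \<cdot> y')\<close>: the first half
      is uniform in y', the second is continuity in one variable.\<close>
    moreover have "\<bar>F (x' \<cdot> y') - F (x \<cdot> y)\<bar> < 1" if "x' \<in> V" "y' \<in> W" for x' y'
    proof -
      have "y' \<in> kernel" "\<bar>F (x \<cdot> y') - F (x \<cdot> y)\<bar> < 1 / 2" using that(2) by (auto simp: W_def)
      then show ?thesis using V(3)[OF that(1), of y'] by linarith
    qed
    ultimately show "\<exists>V. openin (prod_topology Y Y) V \<and> z \<in> V \<and>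
        (\<forall>z'\<in>V. \<bar>F (case z' of (x, y) \<Rightarrow> x \<otimes>\<^bsub>kgroup\<^esub> y) - F (case z of (x, y) \<Rightarrow> x \<otimes>\<^bsub>kgroup\<^esub> y)\<bar> < 1)"
      using z by (intro exI[of _ "V \<times> W"]) auto
  qed auto
  moreover have "continuous_map Y Y (\<lambda>x. inv\<^bsub>kgroup\<^esub> x)"
  proof (rule continuous_map_into_compact_Hausdorff[OF compact_Y Hausdorff_Y])
    fix F x assume F: "continuous_map Y euclideanreal F" and "x \<in> topspace Y"
    then have x: "x \<in> kernel" by simp
    obtain V where V: "openin Y V" "x \<in> V"
        "\<And>x' y. \<lbrakk>x' \<in> V; y \<in> kernel\<rbrakk> \<Longrightarrow> \<bar>F (x' \<cdot> y) - F (x \<cdot> y)\<bar> < 1"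
      using equicontinuous_Y[OF F _ x, of 1] by auto
    have "\<bar>F (inv\<^bsub>kgroup\<^esub> x') - F (inv\<^bsub>kgroup\<^esub> x)\<bar> < 1" if x': "x' \<in> V" for x'
    proof -
      have x'K: "x' \<in> kernel" using x' openin_subset[OF V(1)] by auto
      let ?a = "inv\<^bsub>kgroup\<^esub> x" and ?b = "inv\<^bsub>kgroup\<^esub> x'"
      have ab: "?a \<in> kernel" "?b \<in> kernel" using G.inv_closed x x'K by auto
      have "x \<cdot> ?a = \<one>\<^bsub>kgroup\<^esub>" "x' \<cdot> ?b = \<one>\<^bsub>kgroup\<^esub>"
        using G.r_inv x x'K by auto
      \<comment> \<open>The element \<open>?b \<cdot> ?a\<close> exchanges the inverses: x' sends it
        to the inverse of x, and x sends it to the inverse of x'. It varies with x', so the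
        uniformity in y is essential.\<close>
      then have "x' \<cdot> (?b \<cdot> ?a) = ?a" "x \<cdot> (?b \<cdot> ?a) = ?b"
        using ab x x'K kernel_identity by (metis assoc kernel_S, metis assoc comm kernel_S)
      then show ?thesis using V(3)[OF x', of "?b \<cdot> ?a"] ab by (simp add: abs_minus_commute)
    qed
    then show "\<exists>V. openin Y V \<and> x \<in> V \<and> (\<forall>x'\<in>V. \<bar>F (inv\<^bsub>kgroup\<^esub> x') - F (inv\<^bsub>kgroup\<^esub> x)\<bar> < 1)"
      using V by blast
  qed (use G.inv_closed in auto)
  ultimately show ?thesis
    using group_kgroup compact_Y Hausdorff_Y
    by (simp add: compact_topological_group_def topological_group_on_def)
qed


section \<open>Translation invariance and uniqueness of the Haar integral\<close>

lemma haar_borel: "normalized_haar_measure kgroup Y \<beta> \<Longrightarrow> borel_measure_on Y \<beta>"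
  by (simp add: normalized_haar_measure_def borel_measure_on_def)

lemma haar_prob: "normalized_haar_measure kgroup Y \<beta> \<Longrightarrow> emeasure \<beta> (space \<beta>) = 1"
  unfolding normalized_haar_measure_def by (elim conjE)

lemma haar_space: "normalized_haar_measure kgroup Y \<beta> \<Longrightarrow> space \<beta> = kernel"
  by (simp add: normalized_haar_measure_def)

lemma haar_integrable:
  assumes "normalized_haar_measure kgroup Y \<beta>" "continuous_map Y euclideanreal F"
  shows "integrable \<beta> F"
  using assms haar_prob
  by (intro borel_measure_on_integrable[OF haar_borel _ compact_Y] finite_measureI) auto

text \<open>Haar measures are invariant for images of sets, whereas \<open>distr\<close> works with
  preimages. Translation by g is onto the kernel, so it maps the preimage of B onto B, and the two
  notions agree.\<close>

lemma haar_integral_translate: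
  assumes \<beta>: "normalized_haar_measure kgroup Y \<beta>" and F: "continuous_map Y euclideanreal F"
    and g: "g \<in> kernel"
  shows "(LINT x|\<beta>. F (g \<cdot> x)) = (LINT x|\<beta>. F x)"
proof -
  have sp: "space \<beta> = kernel" and b: "borel_measure_on Y \<beta>"
    using \<beta> by (simp_all add: haar_space haar_borel)
  have sets: "sets \<beta> = sigma_sets kernel {U. openin Y U}"
    using b by (simp add: borel_measure_on_def)
  have meas: "(\<lambda>x. g \<cdot> x) \<in> measurable \<beta> \<beta>"
  proof (rule measurable_sigma_sets[OF sets])
    show "{U. openin Y U} \<subseteq> Pow kernel" using openin_subset[of Y] by auto
    show "(\<lambda>x. g \<cdot> x) -` U \<inter> space \<beta> \<in> sets \<beta>" if "U \<in> {U. openin Y U}" for U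
    proof -
      have "openin Y {x \<in> topspace Y. g \<cdot> x \<in> U}"
        using that cont_left_Y[OF g] by (intro openin_continuous_map_preimage) auto
      moreover have "(\<lambda>x. g \<cdot> x) -` U \<inter> space \<beta> = {x \<in> topspace Y. g \<cdot> x \<in> U}"
        using sp by auto
      ultimately show ?thesis using borel_measure_on_open[OF b] by simp
    qed
  qed (use sp g in auto)
  have "distr \<beta> \<beta> (\<lambda>x. g \<cdot> x) = \<beta>"
  proof (rule measure_eqI)
    fix B assume "B \<in> sets (distr \<beta> \<beta> (\<lambda>x. g \<cdot> x))"
    then have B: "B \<in> sets \<beta>" by simp
    define B' where "B' = (\<lambda>x. g \<cdot> x) -` B \<inter> space \<beta>"
    have B': "B' \<in> sets \<beta>" unfolding B'_def using meas B by (rule measurable_sets)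
    have "B \<subseteq> kernel" using sets.sets_into_space[OF B] sp by simp
    have "(\<lambda>x. g \<cdot> x) ` B' = B"
    proof
      show "B \<subseteq> (\<lambda>x. g \<cdot> x) ` B'"
      proof
        fix x assume x: "x \<in> B"
        then have "x \<in> kernel" using \<open>B \<subseteq> kernel\<close> by blast
        then obtain y where "y \<in> kernel" "x = g \<cdot> y" using kernel_divisible[OF g] by blast
        then show "x \<in> (\<lambda>x. g \<cdot> x) ` B'" using x sp by (auto simp: B'_def)
      qed
    qed (auto simp: B'_def)
    moreover have "emeasure \<beta> ((\<lambda>x. g \<cdot> x) ` B') = emeasure \<beta> B'"
      using \<beta> g B' by (simp add: normalized_haar_measure_def)
    ultimately show "emeasure (distr \<beta> \<beta> (\<lambda>x. g \<cdot> x)) B = emeasure \<beta> B"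
      using emeasure_distr[OF meas B] by (simp add: B'_def)
  qed simp
  then have "(LINT x|\<beta>. F x) = (LINT x|distr \<beta> \<beta> (\<lambda>x. g \<cdot> x). F x)" by simp
  also have "\<dots> = (LINT x|\<beta>. F (g \<cdot> x))"
    using meas borel_measure_on_measurable[OF b F] by (rule integral_distr)
  finally show ?thesis by simp
qed

text \<open>By equicontinuity the invariant integral \<open>N\<^sub>0\<close> of \<open>F\<close> is, uniformly on the kernel, a limit of
  convex combinations of translates of \<open>F\<close>; any other invariant integral therefore agrees with it.
  This avoids Fubini's theorem, whose measurability hypotheses fail to be automatic on
  non-metrizable groups.\<close>

lemma haar_integral_unique:
  assumes \<beta>: "normalized_haar_measure kgroup Y \<beta>" and \<beta>0: "normalized_haar_measure kgroup Y \<beta>0"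
    and F: "continuous_map Y euclideanreal F"
  shows "(LINT x|\<beta>. F x) = (LINT x|\<beta>0. F x)"
proof -
  interpret B: finite_measure \<beta> by (rule finite_measureI) (simp add: haar_prob[OF \<beta>])
  interpret B0: finite_measure \<beta>0 by (rule finite_measureI) (simp add: haar_prob[OF \<beta>0])
  have m1: "measure \<beta> (space \<beta>) = 1" "measure \<beta>0 (space \<beta>0) = 1"
    by (simp_all add: measure_def haar_prob[OF \<beta>] haar_prob[OF \<beta>0])
  define N N0 where "N = (LINT x|\<beta>. F x)" and "N0 = (LINT x|\<beta>0. F x)"
  \<comment> \<open>Left invariance also covers translation by y on the right, through
    commutativity.\<close>
  have right0: "(LINT x|\<beta>0. F (x \<cdot> y)) = N0" if "y \<in> kernel" for y
  proof -
    have "(LINT x|\<beta>0. F (x \<cdot> y)) = (LINT x|\<beta>0. F (y \<cdot> x))"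
      using that haar_space[OF \<beta>0] by (intro Bochner_Integration.integral_cong) (auto simp: comm)
    then show ?thesis using haar_integral_translate[OF \<beta>0 F that] by (simp add: N0_def)
  qed
  have contl: "continuous_map Y euclideanreal (\<lambda>y. F (x \<cdot> y))" if "x \<in> kernel" for x
    using continuous_map_compose[OF cont_left_Y[OF that] F] by (simp add: o_def)
  have contr: "continuous_map Y euclideanreal (\<lambda>x. F (x \<cdot> y))" if "y \<in> kernel" for y
    by (rule continuous_map_eq[OF contl[OF that]]) (use that in \<open>auto simp: comm\<close>)
  have "\<bar>N - N0\<bar> \<le> e" if "e > 0" for e
  proof -
    have "\<forall>x\<in>kernel. \<exists>V. openin Y V \<and> x \<in> V \<and> (\<forall>x'\<in>V. \<forall>y\<in>kernel. \<bar>F (x' \<cdot> y) - F (x \<cdot> y)\<bar> < e)"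
      using equicontinuous_Y[OF F \<open>e > 0\<close>] by metis
    then obtain V where V: "\<And>x. x \<in> kernel \<Longrightarrow> openin Y (V x)" "\<And>x. x \<in> kernel \<Longrightarrow> x \<in> V x"
      "\<And>x x' y. \<lbrakk>x \<in> kernel; x' \<in> V x; y \<in> kernel\<rbrakk> \<Longrightarrow> \<bar>F (x' \<cdot> y) - F (x \<cdot> y)\<bar> < e"
      by metis
    have "(\<Union>x\<in>kernel. V x) = topspace Y"
      using V(1,2) openin_subset[of Y] by fastforce
    then obtain \<F> where "finite \<F>" "\<F> \<subseteq> V ` kernel" "\<Union>\<F> = topspace Y"
      using compact_Y V(1) unfolding compact_space by (metis (no_types, lifting) imageE)
    then obtain P where P: "finite P" "P \<subseteq> kernel" "(\<Union>x\<in>P. V x) = kernel"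
      by (metis finite_subset_image topspace_Y)
    obtain n and p :: "nat \<Rightarrow> 'a" where p: "bij_betw p {..<n} P"
      using ex_bij_betw_nat_finite[OF P(1)] by (auto simp: atLeast0LessThan)
    have pK: "p i \<in> kernel" if "i < n" for i
      using p P(2) that by (auto simp: bij_betw_def)
    have cover: "\<exists>i<n. x \<in> V (p i)" if "x \<in> kernel" for x
      using P(3) that p by (force simp: bij_betw_def)
    \<comment> \<open>A disjoint refinement of the cover: for i < n, a point x of the kernel lies in
      \<open>B i\<close> exactly if i is the least index with x in \<open>V (p i)\<close>.\<close>
    define B where "B i = V (p i) - (\<Union>j<i. V (p j))" for i
    have Bs: "B i \<in> sets \<beta>0" if "i < n" for i
      using that pK V(1) borel_measure_on_open[OF haar_borel[OF \<beta>0]]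
      unfolding B_def by (intro sets.Diff sets.finite_UN) auto
    have one: "(\<Sum>i<n. indicator (B i) x * c i) = c (LEAST i. x \<in> V (p i)) \<and> (LEAST i. x \<in> V (p i)) < n
        \<and> x \<in> V (p (LEAST i. x \<in> V (p i)))" if x: "x \<in> kernel" for x and c :: "nat \<Rightarrow> real"
    proof -
      let ?l = "LEAST i. x \<in> V (p i)"
      obtain i where i: "i < n" "x \<in> V (p i)" using cover[OF x] by blast
      have l: "x \<in> V (p ?l)" using i(2) by (rule LeastI)
      have ln: "?l < n" using Least_le[of "\<lambda>i. x \<in> V (p i)", OF i(2)] i(1) by simp
      have "x \<in> B i \<longleftrightarrow> i = ?l" for i
      proof
        assume xi: "x \<in> B i"
        then have "?l \<le> i" unfolding B_def by (intro Least_le) simp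
        moreover have "\<not> ?l < i" using xi l unfolding B_def by blast
        ultimately show "i = ?l" by simp
      next
        have "x \<notin> V (p j)" if "j < ?l" for j using that by (rule not_less_Least)
        then have "x \<in> B ?l" using l unfolding B_def by blast
        then show "i = ?l \<Longrightarrow> x \<in> B i" by simp
      qed
      then have "(\<Sum>i<n. indicator (B i) x * c i) = (\<Sum>i<n. if i = ?l then c i else 0)"
        by (intro sum.cong) (auto simp: indicator_def)
      then show ?thesis using l ln by simp
    qed
    \<comment> \<open>The weights of the convex combination are the \<beta>0-masses of the
      pieces.\<close>
    define w where "w i = measure \<beta>0 (B i)" for i
    have wi: "(LINT x|\<beta>0. (\<Sum>i<n. indicator (B i) x * c i)) = (\<Sum>i<n. w i * c i)" for c :: "nat \<Rightarrow> real"
      using Bs sets.sets_into_space[OF Bs]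
      by (subst Bochner_Integration.integral_sum)
        (auto simp: w_def Int_absorb2 less_top[symmetric] intro!: integrable_mult_left integrable_real_indicator sum.cong)
    have w1: "(\<Sum>i<n. w i) = 1"
    proof -
      have "(\<Sum>i<n. w i * 1) = (LINT x|\<beta>0. 1)"
        unfolding wi[symmetric] using one[of _ "\<lambda>_. 1"] haar_space[OF \<beta>0]
        by (intro Bochner_Integration.integral_cong) auto
      then show ?thesis using m1 by simp
    qed
    have int0: "integrable \<beta>0 (\<lambda>x. \<Sum>i<n. indicator (B i) x * c i)" for c :: "nat \<Rightarrow> real"
      by (intro Bochner_Integration.integrable_sum integrable_mult_left integrable_real_indicator)
        (use Bs in \<open>auto simp: less_top[symmetric]\<close>)
    \<comment> \<open>Here x is integrated by \<beta>0 and replaced by the point \<open>p i\<close>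
      of its piece, while y is a parameter. The bound is uniform in y, so \<beta> may integrate over
      y afterwards.\<close>
    have conv: "\<bar>N0 - (\<Sum>i<n. w i * F (p i \<cdot> y))\<bar> \<le> e" if y: "y \<in> kernel" for y
    proof -
      have "N0 - (\<Sum>i<n. w i * F (p i \<cdot> y))
          = (LINT x|\<beta>0. F (x \<cdot> y) - (\<Sum>i<n. indicator (B i) x * F (p i \<cdot> y)))"
        using right0[OF y] wi[of "\<lambda>i. F (p i \<cdot> y)"] int0
        by (subst Bochner_Integration.integral_diff) (auto intro: haar_integrable[OF \<beta>0] contr y)
      also have "\<bar>\<dots>\<bar> \<le> (LINT x|\<beta>0. \<bar>F (x \<cdot> y) - (\<Sum>i<n. indicator (B i) x * F (p i \<cdot> y))\<bar>)"
        by (rule integral_abs_bound)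
      also have "\<dots> \<le> (LINT x|\<beta>0. e)"
      proof (rule integral_mono)
        fix x assume "x \<in> space \<beta>0"
        then have x: "x \<in> kernel" using haar_space[OF \<beta>0] by simp
        show "\<bar>F (x \<cdot> y) - (\<Sum>i<n. indicator (B i) x * F (p i \<cdot> y))\<bar> \<le> e"
          using one[OF x, of "\<lambda>i. F (p i \<cdot> y)"] V(3)[OF pK _ y] by (auto intro: less_imp_le)
      next
        show "integrable \<beta>0 (\<lambda>x. \<bar>F (x \<cdot> y) - (\<Sum>i<n. indicator (B i) x * F (p i \<cdot> y))\<bar>)"
          by (intro integrable_abs Bochner_Integration.integrable_diff int0 haar_integrable[OF \<beta>0] contr y)
      qed simp
      also have "\<dots> = e" using m1 by simp
      finally show ?thesis .
    qed
    have sint: "(LINT y|\<beta>. (\<Sum>i<n. w i * F (p i \<cdot> y))) = N"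
    proof -
      have "(LINT y|\<beta>. (\<Sum>i<n. w i * F (p i \<cdot> y))) = (\<Sum>i<n. w i * (LINT y|\<beta>. F (p i \<cdot> y)))"
        using pK by (subst Bochner_Integration.integral_sum)
          (auto intro!: integrable_mult_right haar_integrable[OF \<beta>] contl)
      also have "\<dots> = (\<Sum>i<n. w i * N)"
        using haar_integral_translate[OF \<beta> F pK] by (intro sum.cong) (auto simp: N_def)
      also have "\<dots> = N" by (simp add: w1 flip: sum_distrib_right)
      finally show ?thesis .
    qed
    have ints: "integrable \<beta> (\<lambda>y. \<Sum>i<n. w i * F (p i \<cdot> y))"
      by (intro Bochner_Integration.integrable_sum integrable_mult_right haar_integrable[OF \<beta>] contl pK) auto
    have "N0 - N = (LINT y|\<beta>. N0 - (\<Sum>i<n. w i * F (p i \<cdot> y)))"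
      using ints m1 sint by (subst Bochner_Integration.integral_diff) auto
    also have "\<bar>\<dots>\<bar> \<le> (LINT y|\<beta>. \<bar>N0 - (\<Sum>i<n. w i * F (p i \<cdot> y))\<bar>)"
      by (rule integral_abs_bound)
    also have "\<dots> \<le> (LINT y|\<beta>. e)"
      using ints conv haar_space[OF \<beta>] by (intro integral_mono) auto
    also have "\<dots> = e" using m1 by simp
    finally show ?thesis by (simp add: abs_minus_commute)
  qed
  then have "\<bar>N - N0\<bar> \<le> 0" by (rule field_le_epsilon) simp
  then show ?thesis by (simp add: N_def N0_def)
qed

end

section \<open>The spectrum and the Gelfand transformation\<close>

lemma lattice_Min_exists:
  fixes L :: "('a \<Rightarrow> real) set"
  assumes "finite P" "P \<noteq> {}" "\<And>p. p \<in> P \<Longrightarrow> f p \<in> L"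
    and min: "\<And>f g. \<lbrakk>f \<in> L; g \<in> L\<rbrakk> \<Longrightarrow> (\<lambda>x. min (f x) (g x)) \<in> L"
  shows "\<exists>g\<in>L. \<forall>x. (\<forall>p\<in>P. g x \<le> f p x) \<and> (\<exists>p\<in>P. g x = f p x)"
  using assms(1-3)
proof (induction P rule: finite_ne_induct)
  case (insert p P)
  then obtain g where g: "g \<in> L" "\<And>x. \<forall>p\<in>P. g x \<le> f p x" "\<And>x. \<exists>p\<in>P. g x = f p x" by auto
  have "(\<forall>q\<in>insert p P. min (f p x) (g x) \<le> f q x) \<and> (\<exists>q\<in>insert p P. min (f p x) (g x) = f q x)" for x
    using g(2,3)[of x] by (auto simp: min_def intro: order_trans)
  moreover have "(\<lambda>x. min (f p x) (g x)) \<in> L" using min g insert.prems by simp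
  ultimately show ?case by (intro bexI allI)
qed auto

text \<open>Kakutani-Stone: a finite minimum of functions interpolating \<phi> at x and y stays
  below \<phi> + e and equals \<phi> at x. A finite maximum of these, obtained as the negative of a
  minimum of negatives, also exceeds \<phi> - e. The attainment clause of
  \<open>lattice_Min_exists\<close> preserves the value at x in the first step and the upper bound
  in the second.\<close>

lemma lattice_Stone_Weierstrass:
  fixes L :: "('a \<Rightarrow> real) set"
  assumes X: "compact_space X" and cont: "\<And>f. f \<in> L \<Longrightarrow> continuous_map X euclideanreal f"
    and min: "\<And>f g. \<lbrakk>f \<in> L; g \<in> L\<rbrakk> \<Longrightarrow> (\<lambda>x. min (f x) (g x)) \<in> L"
    and neg: "\<And>f. f \<in> L \<Longrightarrow> (\<lambda>x. - f x) \<in> L"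
    and interpolate: "\<And>x y a b. \<lbrakk>x \<in> topspace X; y \<in> topspace X; x = y \<Longrightarrow> a = b\<rbrakk> \<Longrightarrow> \<exists>f\<in>L. f x = a \<and> f y = b"
    and \<phi>: "continuous_map X euclideanreal \<phi>" and "e > 0" and ne: "topspace X \<noteq> {}"
  shows "\<exists>f\<in>L. \<forall>x\<in>topspace X. \<bar>f x - \<phi> x\<bar> < e"
proof -
  have cover: "\<exists>P. finite P \<and> P \<noteq> {} \<and> P \<subseteq> topspace X \<and> (\<forall>y\<in>topspace X. \<exists>p\<in>P. y \<in> U p)"
    if U: "\<And>y. y \<in> topspace X \<Longrightarrow> openin X (U y) \<and> y \<in> U y" for U
  proof -
    have "(\<Union>x\<in>topspace X. U x) = topspace X" using U openin_subset by fastforce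
    then obtain \<F> where "finite \<F>" "\<F> \<subseteq> U ` topspace X" "\<Union>\<F> = topspace X"
      using X U unfolding compact_space by (metis (no_types, lifting) imageE)
    then obtain P where P: "finite P" "P \<subseteq> topspace X" "(\<Union>x\<in>P. U x) = topspace X"
      by (metis finite_subset_image)
    have "P \<noteq> {}" using ne[folded P(3)] by blast
    have "\<forall>y\<in>topspace X. \<exists>p\<in>P. y \<in> U p" unfolding P(3)[symmetric] by (intro ballI) (simp only: UN_iff)
    then show ?thesis using P(1,2) \<open>P \<noteq> {}\<close> by (intro exI[of _ P] conjI)
  qed
  have step: "\<exists>g\<in>L. g x = \<phi> x \<and> (\<forall>y\<in>topspace X. g y < \<phi> y + e)" if x: "x \<in> topspace X" for x
  proof -
    have "\<forall>y\<in>topspace X. \<exists>f\<in>L. f x = \<phi> x \<and> f y = \<phi> y" using interpolate x by metis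
    then obtain f where f: "\<And>y. y \<in> topspace X \<Longrightarrow> f y \<in> L \<and> f y x = \<phi> x \<and> f y y = \<phi> y" by metis
    have "openin X {z \<in> topspace X. f y z - \<phi> z \<in> {..<e}}" if "y \<in> topspace X" for y
      using f[OF that] cont \<phi>
      by (intro openin_continuous_map_preimage[where Y = euclideanreal] continuous_intros) auto
    then obtain P where P: "finite P" "P \<noteq> {}" "P \<subseteq> topspace X"
      "\<forall>y\<in>topspace X. \<exists>p\<in>P. y \<in> {z \<in> topspace X. f p z - \<phi> z \<in> {..<e}}"
      using cover[of "\<lambda>y. {z \<in> topspace X. f y z - \<phi> z \<in> {..<e}}"] f \<open>e > 0\<close> by auto
    have "\<And>p. p \<in> P \<Longrightarrow> f p \<in> L" using P(3) f by blast
    then obtain g where g: "g \<in> L" "\<And>y. (\<forall>p\<in>P. g y \<le> f p y) \<and> (\<exists>p\<in>P. g y = f p y)"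
      using lattice_Min_exists[of P f L, OF P(1,2) _ min] by blast
    have "g x = \<phi> x" using g(2)[of x] P(3) f by auto
    moreover have "g y < \<phi> y + e" if y: "y \<in> topspace X" for y
    proof -
      obtain p where "p \<in> P" "f p y - \<phi> y < e" using P(4) y by auto
      then show ?thesis using g(2)[of y] by force
    qed
    ultimately show ?thesis using g(1) by blast
  qed
  then obtain g where g: "\<And>x. x \<in> topspace X \<Longrightarrow> g x \<in> L \<and> g x x = \<phi> x \<and> (\<forall>y\<in>topspace X. g x y < \<phi> y + e)"
    by metis
  have "openin X {z \<in> topspace X. \<phi> z - g x z \<in> {..<e}}" if "x \<in> topspace X" for x
    using g[OF that] cont \<phi>
    by (intro openin_continuous_map_preimage[where Y = euclideanreal] continuous_intros) auto
  then obtain P where P: "finite P" "P \<noteq> {}" "P \<subseteq> topspace X"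
    "\<forall>y\<in>topspace X. \<exists>p\<in>P. y \<in> {z \<in> topspace X. \<phi> z - g p z \<in> {..<e}}"
    using cover[of "\<lambda>x. {z \<in> topspace X. \<phi> z - g x z \<in> {..<e}}"] g \<open>e > 0\<close> by auto
  have "\<And>p. p \<in> P \<Longrightarrow> (\<lambda>x. - g p x) \<in> L" using P(3) g neg by blast
  then obtain h where h: "h \<in> L" "\<And>y. (\<forall>p\<in>P. h y \<le> - g p y) \<and> (\<exists>p\<in>P. h y = - g p y)"
    using lattice_Min_exists[of P "\<lambda>p x. - g p x" L, OF P(1,2) _ min] by blast
  have "\<bar>- h y - \<phi> y\<bar> < e" if y: "y \<in> topspace X" for y
  proof -
    obtain p where "p \<in> P" "\<phi> y - g p y < e" using P(4) y by auto
    moreover obtain q where "q \<in> P" "h y = - g q y" using h(2) by blast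
    moreover have "g q y < \<phi> y + e" using g P(3) \<open>q \<in> P\<close> y by blast
    moreover have "h y \<le> - g p y" using h(2) \<open>p \<in> P\<close> by blast
    ultimately show ?thesis by linarith
  qed
  then show ?thesis by (intro bexI[OF _ neg[OF h(1)]] ballI)
qed

lemma bounded_on_rangeE:
  fixes u :: "'a \<Rightarrow> real"
  assumes "bounded (range u)"
  obtains B where "B > 0" "\<And>x. \<bar>u x\<bar> \<le> B"
  using assms unfolding bounded_pos by auto

section \<open>Closure of the algebra under uniform limits and continuous functions\<close>

locale mean_value_algebra =
  fixes A :: "(real ^ 'n \<Rightarrow> real) set"
  assumes amv: "algebra_with_mean_value A"
begin

lemma const [simp]: "(\<lambda>x. c) \<in> A"
  using amv by (simp add: algebra_with_mean_value_def)

lemma add [simp]: "\<lbrakk>u \<in> A; v \<in> A\<rbrakk> \<Longrightarrow> (\<lambda>x. u x + v x) \<in> A"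
  using amv by (simp add: algebra_with_mean_value_def)

lemma mult [simp]: "\<lbrakk>u \<in> A; v \<in> A\<rbrakk> \<Longrightarrow> (\<lambda>x. u x * v x) \<in> A"
  using amv by (simp add: algebra_with_mean_value_def)

lemma translate [simp]: "u \<in> A \<Longrightarrow> translate a u \<in> A"
  using amv by (simp add: algebra_with_mean_value_def)

lemma has_mean: "u \<in> A \<Longrightarrow> \<exists>m. has_mean_value u m"
  using amv by (simp add: algebra_with_mean_value_def)

lemma bounded: "u \<in> A \<Longrightarrow> bounded (range u)"
  using amv by (auto simp: algebra_with_mean_value_def buc_def)

lemma continuous: "u \<in> A \<Longrightarrow> continuous_on UNIV u"
  using amv by (auto simp: algebra_with_mean_value_def buc_def intro: uniformly_continuous_imp_continuous)

lemma scale [simp]: "u \<in> A \<Longrightarrow> (\<lambda>x. c * u x) \<in> A"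
  using mult[OF const] .

lemma minus [simp]: "u \<in> A \<Longrightarrow> (\<lambda>x. - u x) \<in> A"
  using scale[of u "-1"] by simp

lemma diff [simp]: "\<lbrakk>u \<in> A; v \<in> A\<rbrakk> \<Longrightarrow> (\<lambda>x. u x - v x) \<in> A"
  using add[OF _ minus, of u v] by simp

lemma sum [simp]: "(\<And>i. i \<in> J \<Longrightarrow> u i \<in> A) \<Longrightarrow> (\<lambda>x. \<Sum>i\<in>J. u i x) \<in> A"
  by (induction J rule: infinite_finite_induct) auto

lemma bcontfun_iff: "u \<in> A \<Longrightarrow> u \<in> bcontfun"
  using bounded continuous by (auto simp: bcontfun_def)

text \<open>Puts closedness in the space of bounded continuous functions into \<epsilon>-form.
  \<open>Bcontfun u\<close> is meaningful only once u is known to be bounded and continuous, so this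
  comes first.\<close>

lemma uniform_closed:
  fixes u :: "real ^ 'n \<Rightarrow> real"
  assumes approx: "\<And>e. e > 0 \<Longrightarrow> \<exists>f\<in>A. \<forall>x. \<bar>f x - u x\<bar> < e"
  shows "u \<in> A"
proof -
  obtain f0 where f0: "f0 \<in> A" "\<And>x. \<bar>f0 x - u x\<bar> < 1" using approx[of 1] by auto
  obtain B where B: "\<And>x. \<bar>f0 x\<bar> \<le> B" using bounded_on_rangeE[OF bounded[OF f0(1)]] by metis
  have "\<bar>u x\<bar> \<le> B + 1" for x using f0(2)[of x] B[of x] by linarith
  then have ub: "bounded (range u)" by (auto simp: bounded_iff)
  have "\<forall>n. \<exists>f\<in>A. \<forall>x. \<bar>f x - u x\<bar> < inverse (real (Suc n))"
    by (intro allI approx) simp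
  then obtain f where f: "\<And>n. f n \<in> A" "\<And>n x. \<bar>f n x - u x\<bar> < inverse (real (Suc n))"
    by metis
  have "uniform_limit UNIV f u sequentially"
  proof (rule uniform_limitI)
    fix e :: real assume "e > 0"
    then obtain N where N: "inverse (real (Suc N)) < e" using reals_Archimedean by blast
    have "dist (f n x) (u x) < e" if "n \<ge> N" for n x
    proof -
      have "inverse (real (Suc n)) \<le> inverse (real (Suc N))" using that by simp
      then show ?thesis using f(2)[of n x] N unfolding dist_real_def by linarith
    qed
    then show "\<forall>\<^sub>F n in sequentially. \<forall>x\<in>UNIV. dist (f n x) (u x) < e"
      unfolding eventually_sequentially by blast
  qed
  moreover have "continuous_on UNIV (f n)" for n
    using continuous[OF f(1)] .
  ultimately have "continuous_on UNIV u"
    by (intro uniform_limit_theorem[where F = sequentially]) auto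
  with ub have u: "u \<in> bcontfun" by (auto simp: bcontfun_def)
  have cl: "closed {v. apply_bcontfun v \<in> A}"
    using amv by (simp add: algebra_with_mean_value_def)
  have "Bcontfun u \<in> closure {v. apply_bcontfun v \<in> A}"
    unfolding closure_approachable
  proof (intro allI impI)
    fix e :: real assume "e > 0"
    then obtain f where f: "f \<in> A" "\<And>x. \<bar>f x - u x\<bar> < e / 2" using approx[of "e/2"] by auto
    have "dist (Bcontfun f) (Bcontfun u) \<le> e / 2"
      using f u bcontfun_iff by (intro dist_bound) (auto simp: Bcontfun_inverse dist_real_def less_imp_le)
    then show "\<exists>y\<in>{v. apply_bcontfun v \<in> A}. dist y (Bcontfun u) < e"
      using f \<open>e > 0\<close> by (intro bexI[of _ "Bcontfun f"]) (auto simp: Bcontfun_inverse bcontfun_iff)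
  qed
  then have "Bcontfun u \<in> {v. apply_bcontfun v \<in> A}" using cl by simp
  then show ?thesis using u by (simp add: Bcontfun_inverse)
qed

lemma polynomial_compose:
  assumes "real_polynomial_function g" "u \<in> A"
  shows "(\<lambda>x. g (u x :: real)) \<in> A"
  using assms(1)
proof induction
  case (linear f)
  then obtain c where "f = (\<lambda>x. x * c)" using real_bounded_linear by auto
  then show ?case using assms(2) by (simp add: mult[OF _ const])
qed (use assms in auto)

lemma continuous_compose:
  fixes \<phi> :: "real \<Rightarrow> real"
  assumes u: "u \<in> A" and \<phi>: "continuous_on UNIV \<phi>"
  shows "(\<lambda>x. \<phi> (u x)) \<in> A"
proof (rule uniform_closed)
  fix e :: real assume "e > 0"
  obtain B where B: "\<And>x. \<bar>u x\<bar> \<le> B" using bounded_on_rangeE[OF bounded[OF u]] by metis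
  have "continuous_on {-B..B} \<phi>" using \<phi> continuous_on_subset by blast
  then obtain g where g: "real_polynomial_function g" "\<And>t. t \<in> {-B..B} \<Longrightarrow> \<bar>\<phi> t - g t\<bar> < e"
    using Stone_Weierstrass_real_polynomial_function[of "{-B..B}" \<phi> e] \<open>e > 0\<close> by blast
  have "\<bar>g (u x) - \<phi> (u x)\<bar> < e" for x
    using g(2)[of "u x"] B[of x] by (simp add: abs_minus_commute abs_le_iff)
  then show "\<exists>f\<in>A. \<forall>x. \<bar>f x - \<phi> (u x)\<bar> < e"
    by (intro bexI[OF _ polynomial_compose[OF g(1) u]] allI)
qed

lemma abs [simp]: "u \<in> A \<Longrightarrow> (\<lambda>x. \<bar>u x\<bar>) \<in> A"
  by (rule continuous_compose[where \<phi> = "\<lambda>t. \<bar>t\<bar>"]) (auto intro: continuous_intros)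

abbreviation \<Delta> :: "((real ^ 'n \<Rightarrow> real) \<Rightarrow> real) set" where "\<Delta> \<equiv> spectrum A"

lemma char_add: "\<lbrakk>s \<in> \<Delta>; u \<in> A; v \<in> A\<rbrakk> \<Longrightarrow> s (\<lambda>x. u x + v x) = s u + s v"
  by (simp add: spectrum_def)

lemma char_scale: "\<lbrakk>s \<in> \<Delta>; u \<in> A\<rbrakk> \<Longrightarrow> s (\<lambda>x. c * u x) = c * s u"
  by (simp add: spectrum_def)

lemma char_mult: "\<lbrakk>s \<in> \<Delta>; u \<in> A; v \<in> A\<rbrakk> \<Longrightarrow> s (\<lambda>x. u x * v x) = s u * s v"
  by (simp add: spectrum_def)

lemma char_extensional: "s \<in> \<Delta> \<Longrightarrow> s \<in> extensional A"
  by (simp add: spectrum_def)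

lemma char_eqI: "\<lbrakk>s \<in> \<Delta>; t \<in> \<Delta>; \<And>u. u \<in> A \<Longrightarrow> s u = t u\<rbrakk> \<Longrightarrow> s = t"
  using extensionalityI char_extensional by blast

lemma char_const:
  assumes s: "s \<in> \<Delta>" shows "s (\<lambda>x. c) = c"
proof -
  obtain u where u: "u \<in> A" "s u \<noteq> 0" using s by (auto simp: spectrum_def)
  have "s u = s u * s (\<lambda>x. 1)" using char_mult[OF s u(1) const[of 1]] by simp
  then have "s (\<lambda>x. 1) = 1" using u by simp
  then show ?thesis using char_scale[OF s const[of 1], of c] by simp
qed

lemma char_minus: "\<lbrakk>s \<in> \<Delta>; u \<in> A\<rbrakk> \<Longrightarrow> s (\<lambda>x. - u x) = - s u"
  using char_scale[of s u "-1"] by simp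

lemma char_diff: "\<lbrakk>s \<in> \<Delta>; u \<in> A; v \<in> A\<rbrakk> \<Longrightarrow> s (\<lambda>x. u x - v x) = s u - s v"
  using char_add[of s u "\<lambda>x. - v x"] by (simp add: char_minus)

lemma char_sum:
  "\<lbrakk>s \<in> \<Delta>; \<And>i. i \<in> J \<Longrightarrow> u i \<in> A\<rbrakk> \<Longrightarrow> s (\<lambda>x. \<Sum>i\<in>J. u i x) = (\<Sum>i\<in>J. s (u i))"
proof (induction J rule: infinite_finite_induct)
  case (insert j J)
  then show ?case using char_add[of s "u j" "\<lambda>x. \<Sum>i\<in>J. u i x"] by simp
qed (auto simp: char_const)

lemma char_nonneg:
  assumes s: "s \<in> \<Delta>" and u: "u \<in> A" "\<And>x. u x \<ge> 0"
  shows "s u \<ge> 0"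
proof -
  have r: "(\<lambda>x. sqrt (u x)) \<in> A" using u(1)
    by (rule continuous_compose[where \<phi> = "\<lambda>t. sqrt t"]) (auto intro: continuous_intros)
  have "s (\<lambda>x. sqrt (u x) * sqrt (u x)) = s (\<lambda>x. sqrt (u x)) * s (\<lambda>x. sqrt (u x))"
    by (rule char_mult[OF s r r])
  then show ?thesis using u(2) by simp
qed

lemma char_mono:
  assumes "s \<in> \<Delta>" "u \<in> A" "v \<in> A" "\<And>x. u x \<le> v x"
  shows "s u \<le> s v"
  using char_nonneg[of s "\<lambda>x. v x - u x"] assms by (simp add: char_diff)

lemma char_bound:
  assumes "s \<in> \<Delta>" "u \<in> A" "\<And>x. \<bar>u x\<bar> \<le> B"
  shows "\<bar>s u\<bar> \<le> B"
proof -
  have "u x \<le> B" "- B \<le> u x" for x using assms(3)[of x] by linarith+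
  then have "s u \<le> s (\<lambda>x. B)" "s (\<lambda>x. - B) \<le> s u"
    using char_mono[OF assms(1,2) const] char_mono[OF assms(1) const assms(2)] by simp_all
  then show ?thesis unfolding char_const[OF assms(1)] by linarith
qed

lemma char_abs:
  assumes s: "s \<in> \<Delta>" and u: "u \<in> A"
  shows "s (\<lambda>x. \<bar>u x\<bar>) = \<bar>s u\<bar>"
proof -
  have "s (\<lambda>x. \<bar>u x\<bar>) * s (\<lambda>x. \<bar>u x\<bar>) = s (\<lambda>x. u x * u x)"
    using char_mult[OF s abs[OF u] abs[OF u]] by simp
  also have "\<dots> = \<bar>s u\<bar> * \<bar>s u\<bar>" using s u by (simp add: char_mult)
  finally have "(s (\<lambda>x. \<bar>u x\<bar>))\<^sup>2 = \<bar>s u\<bar>\<^sup>2"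
    unfolding power2_eq_square .
  moreover have "0 \<le> s (\<lambda>x. \<bar>u x\<bar>)"
    by (rule char_nonneg[OF s abs[OF u]]) (rule abs_ge_zero)
  ultimately show ?thesis using abs_ge_zero by (rule power2_eq_imp_eq)
qed

definition \<delta> :: "real ^ 'n \<Rightarrow> (real ^ 'n \<Rightarrow> real) \<Rightarrow> real" where
  "\<delta> x = (\<lambda>u\<in>A. u x)"

lemma \<delta>_apply [simp]: "u \<in> A \<Longrightarrow> \<delta> x u = u x"
  by (simp add: \<delta>_def)

lemma \<delta>_in [simp]: "\<delta> x \<in> \<Delta>"
proof -
  have "\<delta> x (\<lambda>x. 1) \<noteq> 0" by simp
  then show ?thesis unfolding spectrum_def
    by (auto simp: \<delta>_def intro!: bexI[of _ "\<lambda>x. 1"])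
qed

abbreviation X :: "((real ^ 'n \<Rightarrow> real) \<Rightarrow> real) topology" where "X \<equiv> spectrum_topology A"

lemma topspace_X [simp]: "topspace X = \<Delta>"
  by (auto simp: spectrum_topology_def spectrum_def PiE_def)

lemma Hausdorff_X: "Hausdorff_space X"
  unfolding spectrum_topology_def
  by (intro Hausdorff_space_subtopology) (simp add: Hausdorff_space_product_topology)

lemma continuous_eval: "u \<in> A \<Longrightarrow> continuous_map X euclideanreal (\<lambda>s. s u)"
  unfolding spectrum_topology_def
  by (intro continuous_map_from_subtopology continuous_map_product_projection)

lemma continuous_into_X:
  assumes "\<And>z. z \<in> topspace Z \<Longrightarrow> f z \<in> \<Delta>" "\<And>u. u \<in> A \<Longrightarrow> continuous_map Z euclideanreal (\<lambda>z. f z u)"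
  shows "continuous_map Z X f"
  using assms char_extensional unfolding spectrum_topology_def
  by (auto simp: continuous_map_in_subtopology continuous_map_componentwise)

lemma compact_X: "compact_space X"
proof -
  let ?P = "product_topology (\<lambda>u. euclideanreal) A"
  have "\<exists>B. \<forall>u\<in>A. \<forall>x. \<bar>u x\<bar> \<le> B u"
    by (rule bchoice) (metis bounded bounded_on_rangeE)
  then obtain B where B: "\<And>u x. u \<in> A \<Longrightarrow> \<bar>u x\<bar> \<le> B u" by blast
  have comp: "compactin ?P (PiE A (\<lambda>u. {- B u..B u}))"
    by (subst compactin_PiE) auto
  have ev: "continuous_map ?P euclideanreal (\<lambda>s. s u)" if "u \<in> A" for u
    using that by (rule continuous_map_product_projection)
  let ?eq = "\<lambda>a b. {s \<in> topspace ?P. a s - b s \<in> {0::real}}"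
  have cl: "closedin ?P (?eq a b)" if "continuous_map ?P euclideanreal a" "continuous_map ?P euclideanreal b" for a b
    using that by (intro closedin_continuous_map_preimage[where Y = euclideanreal] continuous_intros) auto
  have "\<Delta> = (\<Inter>u\<in>A. \<Inter>v\<in>A. ?eq (\<lambda>s. s (\<lambda>x. u x + v x)) (\<lambda>s. s u + s v))
      \<inter> (\<Inter>u\<in>A. \<Inter>c\<in>UNIV. ?eq (\<lambda>s. s (\<lambda>x. c * u x)) (\<lambda>s. c * s u))
      \<inter> (\<Inter>u\<in>A. \<Inter>v\<in>A. ?eq (\<lambda>s. s (\<lambda>x. u x * v x)) (\<lambda>s. s u * s v))
      \<inter> ?eq (\<lambda>s. s (\<lambda>x. 1)) (\<lambda>s. 1)" (is "_ = ?R")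
  proof
    show "\<Delta> \<subseteq> ?R"
      using char_add char_scale char_mult char_const char_extensional by (auto simp: PiE_def)
    show "?R \<subseteq> \<Delta>"
    proof
      fix s assume s: "s \<in> ?R"
      have "s (\<lambda>x. 1) \<noteq> 0" using s by auto
      then have "\<exists>u\<in>A. s u \<noteq> 0" using const by blast
      moreover have "s \<in> extensional A" using s by (auto simp: PiE_def)
      ultimately show "s \<in> \<Delta>" using s by (auto simp: spectrum_def)
    qed
  qed
  moreover have "A \<noteq> {}" using const by blast
  then have "closedin ?P ?R"
    by (intro closedin_Int closedin_INT cl ev continuous_map_add continuous_map_real_mult continuous_map_const[THEN iffD2])
      auto
  ultimately have "closedin ?P \<Delta>" by simp
  moreover have "\<Delta> \<subseteq> PiE A (\<lambda>u. {- B u..B u})"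
  proof
    fix s assume s: "s \<in> \<Delta>"
    have "s u \<in> {- B u..B u}" if u: "u \<in> A" for u
    proof -
      have "\<bar>s u\<bar> \<le> B u" using s u B[OF u] by (rule char_bound)
      then show ?thesis unfolding atLeastAtMost_iff by linarith
    qed
    then show "s \<in> PiE A (\<lambda>u. {- B u..B u})"
      using char_extensional[OF s] by (simp add: PiE_iff)
  qed
  ultimately have "compactin ?P \<Delta>" using comp closed_compactin by blast
  then show ?thesis by (simp add: spectrum_topology_def compact_space_subtopology)
qed

lemma \<delta>_approximates:
  assumes s: "s \<in> \<Delta>" and J: "finite J" "J \<subseteq> A" and "e > 0" and D: "closure D = (UNIV :: (real ^ 'n) set)"
  shows "\<exists>x\<in>D. \<forall>u\<in>J. \<bar>u x - s u\<bar> < e"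
proof -
  define g where "g = (\<lambda>x. \<Sum>u\<in>J. (u x - s u) * (u x - s u))"
  have gA: "g \<in> A" unfolding g_def using J by (intro sum) auto
  have "s g = (\<Sum>u\<in>J. s (\<lambda>x. (u x - s u) * (u x - s u)))"
    unfolding g_def using J s by (intro char_sum) auto
  also have "\<dots> = 0"
  proof (intro sum.neutral ballI)
    fix u assume "u \<in> J"
    then have u: "u \<in> A" using J by blast
    show "s (\<lambda>x. (u x - s u) * (u x - s u)) = 0"
      using char_mult[OF s diff[OF u const] diff[OF u const]] char_diff[OF s u const[of "s u"]]
      by (simp add: char_const[OF s])
  qed
  finally have sg: "s g = 0" .
  have "\<exists>x. g x < e * e"
  proof (rule ccontr)
    assume "\<not> ?thesis"
    then have "\<And>x. e * e \<le> g x" by (meson not_less)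
    then have "s (\<lambda>x. e * e) \<le> s g" by (rule char_mono[OF s const gA])
    then show False
      using mult_pos_pos[OF \<open>e > 0\<close> \<open>e > 0\<close>] unfolding char_const[OF s] sg by linarith
  qed
  moreover have "open {x. g x < e * e}"
    using continuous[OF gA] by (intro open_Collect_less) auto
  ultimately have "{x. g x < e * e} \<inter> D \<noteq> {}"
    using D open_Int_closure_eq_empty[of "{x. g x < e * e}" D] by auto
  then obtain x where x: "x \<in> D" "g x < e * e" by blast
  have "\<bar>u x - s u\<bar> < e" if "u \<in> J" for u
  proof -
    have "(u x - s u) * (u x - s u) \<le> g x"
      unfolding g_def using J that by (intro member_le_sum) auto
    then have "\<bar>u x - s u\<bar>\<^sup>2 < e\<^sup>2" using x(2) by (simp add: power2_eq_square)
    then show ?thesis using \<open>e > 0\<close> power_less_imp_less_base by fastforce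
  qed
  then show ?thesis using x(1) by blast
qed

lemma \<delta>_dense:
  assumes D: "closure D = UNIV"
  shows "X closure_of (\<delta> ` D) = \<Delta>"
proof
  show "X closure_of (\<delta> ` D) \<subseteq> \<Delta>" using closure_of_subset_topspace[of X] by simp
  show "\<Delta> \<subseteq> X closure_of (\<delta> ` D)"
  proof
    fix s assume s: "s \<in> \<Delta>"
    have "\<exists>t. t \<in> \<delta> ` D \<and> t \<in> T" if T: "s \<in> T" "openin X T" for T
    proof -
      obtain W where W: "openin (product_topology (\<lambda>u. euclideanreal) A) W" "T = W \<inter> \<Delta>"
        using T(2) by (auto simp: spectrum_topology_def openin_subtopology)
      then obtain U where U: "finite {i \<in> A. U i \<noteq> UNIV}" "\<forall>i\<in>A. open (U i)" "s \<in> PiE A U" "PiE A U \<subseteq> W"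
        using T(1) unfolding openin_product_topology_alt by fastforce
      have "\<forall>i\<in>A. \<exists>e>0. ball (s i) e \<subseteq> U i"
        using U(2,3) by (auto simp: PiE_def Pi_def open_contains_ball)
      then obtain r where r: "\<And>i. i \<in> A \<Longrightarrow> r i > 0 \<and> ball (s i) (r i) \<subseteq> U i" by metis
      define J where "J = {i \<in> A. U i \<noteq> UNIV}"
      define e where "e = Min (insert 1 (r ` J))"
      have "finite J" using U(1) by (simp add: J_def)
      then have "e > 0" and er: "\<And>i. i \<in> J \<Longrightarrow> e \<le> r i"
        unfolding e_def using r by (auto simp: J_def)
      have "J \<subseteq> A" by (auto simp: J_def)
      then obtain x where x: "x \<in> D" "\<forall>u\<in>J. \<bar>u x - s u\<bar> < e"
        using \<delta>_approximates[OF s \<open>finite J\<close> _ \<open>e > 0\<close> D] by blast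
      have "u x \<in> U u" if u: "u \<in> A" for u
      proof (cases "u \<in> J")
        case True
        then have "dist (s u) (u x) < r u" using x(2) er by (fastforce simp: dist_real_def abs_minus_commute)
        then show ?thesis using r[OF u] by auto
      qed (use u in \<open>auto simp: J_def\<close>)
      then have "\<delta> x \<in> PiE A U" by (auto simp: \<delta>_def)
      then show ?thesis using U(4) W(2) x(1) by (intro exI[of _ "\<delta> x"]) auto
    qed
    then show "s \<in> X closure_of (\<delta> ` D)" using s by (simp add: in_closure_of)
  qed
qed

lemma gelfand_approx:
  assumes \<phi>: "continuous_map X euclideanreal \<phi>" and "e > 0"
  shows "\<exists>u\<in>A. \<forall>s\<in>\<Delta>. \<bar>s u - \<phi> s\<bar> < e"
proof -
  define L where "L = {f. continuous_map X euclideanreal f \<and> (\<exists>u\<in>A. \<forall>s\<in>\<Delta>. f s = s u)}"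
  have "\<exists>f\<in>L. \<forall>x\<in>topspace X. \<bar>f x - \<phi> x\<bar> < e"
  proof (rule lattice_Stone_Weierstrass[OF compact_X _ _ _ _ \<phi> \<open>e > 0\<close>])
    show "(\<lambda>x. min (f x) (g x)) \<in> L" if fg: "f \<in> L" "g \<in> L" for f g
    proof -
      obtain u v where u: "u \<in> A" "\<And>s. s \<in> \<Delta> \<Longrightarrow> f s = s u" and v: "v \<in> A" "\<And>s. s \<in> \<Delta> \<Longrightarrow> g s = s v"
        using fg by (auto simp: L_def)
      have "min (f s) (g s) = s (\<lambda>x. 1/2 * ((u x + v x) - \<bar>u x - v x\<bar>))" if s: "s \<in> \<Delta>" for s
      proof -
        note uv = add[OF u(1) v(1)] abs[OF diff[OF u(1) v(1)]]
        have eq: "s (\<lambda>x. 1/2 * ((u x + v x) - \<bar>u x - v x\<bar>)) = 1/2 * ((s u + s v) - \<bar>s u - s v\<bar>)"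
          using char_scale[OF s diff[OF uv], of "1/2"] char_diff[OF s uv] char_add[OF s u(1) v(1)]
            char_abs[OF s diff[OF u(1) v(1)]] char_diff[OF s u(1) v(1)] by simp
        show ?thesis unfolding eq u(2)[OF s] v(2)[OF s] by (simp add: min_def)
      qed
      moreover have "(\<lambda>x. 1/2 * ((u x + v x) - \<bar>u x - v x\<bar>)) \<in> A"
        using u v by (intro scale diff add abs)
      ultimately show ?thesis using fg unfolding L_def by (auto intro!: continuous_intros)
    qed
    show "(\<lambda>x. - f x) \<in> L" if "f \<in> L" for f
      using that char_minus unfolding L_def by (force intro!: continuous_intros intro: minus)
    show "\<exists>f\<in>L. f s = a \<and> f t = b" if st: "s \<in> topspace X" "t \<in> topspace X" "s = t \<Longrightarrow> a = b" for s t a b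
    proof -
      have inL: "(\<lambda>s. s u) \<in> L" if "u \<in> A" for u
        using that continuous_eval by (auto simp: L_def)
      show ?thesis
      proof (cases "s = t")
        case True
        then show ?thesis using st inL[of "\<lambda>x. a"] by (intro bexI[of _ "\<lambda>s. s (\<lambda>x. a)"]) (auto simp: char_const)
      next
        case False
        then obtain u where u: "u \<in> A" "s u \<noteq> t u" using st char_eqI by auto
        define c where "c = (a - b) / (s u - t u)"
        define v where "v = (\<lambda>x. c * u x + (a - c * s u))"
        have v: "v \<in> A" unfolding v_def using u by (intro add scale const)
        have rv: "r v = c * r u + (a - c * s u)" if "r \<in> \<Delta>" for r
          unfolding v_def char_add[OF that scale[OF u(1)] const] char_scale[OF that u(1)] char_const[OF that] ..
        have "c * t u + (a - c * s u) = b"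
        proof -
          have "c * (s u - t u) = a - b" using u(2) by (simp add: c_def)
          then show ?thesis by (simp add: right_diff_distrib)
        qed
        then show ?thesis using inL[OF v] st rv[of s] rv[of t] by (intro bexI[of _ "\<lambda>s. s v"]) auto
      qed
    qed
    show "topspace X \<noteq> {}" using \<delta>_in by fastforce
  qed (simp add: L_def)
  then obtain f where f: "f \<in> L" "\<And>s. s \<in> \<Delta> \<Longrightarrow> \<bar>f s - \<phi> s\<bar> < e"
    unfolding topspace_X by blast
  obtain u where u: "u \<in> A" "\<And>s. s \<in> \<Delta> \<Longrightarrow> f s = s u"
    using f(1) unfolding L_def by blast
  show ?thesis
  proof (intro bexI[OF _ u(1)] ballI)
    fix s assume "s \<in> \<Delta>"
    then show "\<bar>s u - \<phi> s\<bar> < e" using f(2)[of s] unfolding u(2)[OF \<open>s \<in> \<Delta>\<close>] by simp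
  qed
qed

lemma gelfand_onto:
  assumes \<phi>: "continuous_map X euclideanreal \<phi>"
  shows "(\<lambda>x. \<phi> (\<delta> x)) \<in> A" and "s \<in> \<Delta> \<Longrightarrow> s (\<lambda>x. \<phi> (\<delta> x)) = \<phi> s"
proof -
  show inA: "(\<lambda>x. \<phi> (\<delta> x)) \<in> A"
  proof (rule uniform_closed)
    fix e :: real assume "e > 0"
    then obtain u where u: "u \<in> A" "\<forall>s\<in>\<Delta>. \<bar>s u - \<phi> s\<bar> < e" using gelfand_approx[OF \<phi>] by blast
    then have "\<bar>u x - \<phi> (\<delta> x)\<bar> < e" for x
      using u(2)[rule_format, OF \<delta>_in[of x]] \<delta>_apply[OF u(1), of x] by simp
    then show "\<exists>f\<in>A. \<forall>x. \<bar>f x - \<phi> (\<delta> x)\<bar> < e" using u by blast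
  qed
  assume s: "s \<in> \<Delta>"
  have "\<bar>s (\<lambda>x. \<phi> (\<delta> x)) - \<phi> s\<bar> \<le> 0"
  proof (rule field_le_epsilon)
    fix e :: real assume "e > 0"
    then obtain u where u: "u \<in> A" "\<forall>s\<in>\<Delta>. \<bar>s u - \<phi> s\<bar> < e / 2" using gelfand_approx[OF \<phi>, of "e/2"] by auto
    then have "\<bar>u x - \<phi> (\<delta> x)\<bar> \<le> e / 2" for x
      using u(2)[rule_format, OF \<delta>_in[of x]] \<delta>_apply[OF u(1), of x] by simp
    then have "\<bar>s (\<lambda>x. u x - \<phi> (\<delta> x))\<bar> \<le> e / 2" by (rule char_bound[OF s diff[OF u(1) inA]])
    then have "\<bar>s u - s (\<lambda>x. \<phi> (\<delta> x))\<bar> \<le> e / 2" unfolding char_diff[OF s u(1) inA] .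
    moreover have "\<bar>s u - \<phi> s\<bar> < e / 2" using u(2) s by (rule bspec)
    ultimately show "\<bar>s (\<lambda>x. \<phi> (\<delta> x)) - \<phi> s\<bar> \<le> 0 + e" by linarith
  qed
  then show "s (\<lambda>x. \<phi> (\<delta> x)) = \<phi> s" by simp
qed

end

section \<open>The mean value\<close>

definition tent :: "'a::euclidean_space \<Rightarrow> real" where
  "tent x = max 0 (1 - norm x)"

lemma tent_nonneg: "tent x \<ge> 0"
  by (simp add: tent_def)

lemma continuous_tent: "continuous_on S tent"
  unfolding tent_def by (intro continuous_intros)

lemma tent_measurable [measurable]: "tent \<in> borel_measurable borel"
  by (intro borel_measurable_continuous_onI continuous_tent)

lemma tent_Lipschitz: "\<bar>tent x - tent y\<bar> \<le> norm (x - y)"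
  using norm_triangle_ineq3[of x y] unfolding tent_def by (auto simp: max_def)

lemma tent_translate_diff:
  "\<bar>tent (y - h) - tent y\<bar> \<le> norm h * indicator (cball 0 (1 + norm h)) y"
proof (cases "y \<in> cball 0 (1 + norm h)")
  case True
  then show ?thesis using tent_Lipschitz[of "y - h" y] by simp
next
  case False
  then have "norm y > 1 + norm h" by simp
  moreover have "norm y \<le> norm (y - h) + norm h" using norm_triangle_sub[of y h] by (simp add: add.commute)
  ultimately have "norm (y - h) \<ge> 1" "norm y \<ge> 1" using norm_ge_zero[of h] by linarith+
  then show ?thesis by (simp add: tent_def)
qed

lemma integrable_indicator_cball: "integrable lborel (indicator (cball c r) :: 'a::euclidean_space \<Rightarrow> real)"
  using emeasure_lborel_cball_finite[of c r] by (intro integrable_real_indicator) auto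

lemma integrable_tent: "integrable lborel (tent :: 'a::euclidean_space \<Rightarrow> real)"
proof (rule Bochner_Integration.integrable_bound)
  show "integrable lborel (indicator (cball 0 1) :: 'a \<Rightarrow> real)" by (rule integrable_indicator_cball)
  show "AE x in lborel. norm (tent x) \<le> norm (indicator (cball 0 1) x :: real)" for x :: 'a
    by (auto simp: tent_def indicator_def)
qed simp

lemma integral_tent_pos: "(LINT x|lborel. tent (x :: 'a::euclidean_space)) > 0"
proof -
  have "0 < (1/2) * measure lborel (ball (0::'a) (1/2))"
    by (simp add: content_ball_pos)
  also have "\<dots> = (LINT x|lborel. (1/2) * indicator (ball (0::'a) (1/2)) x)" by simp
  also have "\<dots> \<le> (LINT x|lborel. tent (x :: 'a))"
    using emeasure_lborel_ball_finite[of "0::'a" "1/2"]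
    by (intro integral_mono integrable_tent integrable_mult_right integrable_real_indicator)
      (auto simp: tent_def indicator_def)
  finally show ?thesis .
qed

lemma has_mean_valueD:
  "\<lbrakk>has_mean_value u m; integrable lebesgue g\<rbrakk>
    \<Longrightarrow> ((\<lambda>\<epsilon>. LINT x|lebesgue. u (x /\<^sub>R \<epsilon>) * g x) \<longlongrightarrow> (LINT x|lebesgue. m * g x)) (at_right 0)"
  unfolding has_mean_value_def by (drule spec, erule mp)

lemma has_mean_value_tent:
  fixes u :: "real ^ 'n \<Rightarrow> real"
  assumes "has_mean_value u m" "u \<in> borel_measurable borel"
  shows "((\<lambda>\<epsilon>. LINT x|lborel. u (x /\<^sub>R \<epsilon>) * tent x) \<longlongrightarrow> m * (LINT x|lborel. tent (x :: real ^ 'n))) (at_right 0)"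
proof -
  have [measurable]: "u \<in> borel_measurable borel" by fact
  have "integrable lebesgue (tent :: real ^ 'n \<Rightarrow> real)"
    using integrable_tent by (simp add: integrable_completion)
  then have "((\<lambda>\<epsilon>. LINT x|lebesgue. u (x /\<^sub>R \<epsilon>) * tent x) \<longlongrightarrow> (LINT x|lebesgue. m * tent (x :: real ^ 'n))) (at_right 0)"
    by (rule has_mean_valueD[OF assms(1)])
  then show ?thesis by (simp add: integral_completion)
qed

lemma has_mean_value_unique:
  fixes u :: "real ^ 'n \<Rightarrow> real"
  assumes "has_mean_value u m" "has_mean_value u m'"
  shows "m = m'"
proof -
  have i: "integrable lebesgue (tent :: real ^ 'n \<Rightarrow> real)"
    using integrable_tent by (simp add: integrable_completion)
  have "(LINT x|lebesgue. m * tent (x :: real ^ 'n)) = (LINT x|lebesgue. m' * tent (x :: real ^ 'n))"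
    by (rule tendsto_unique[OF trivial_limit_at_right_real has_mean_valueD[OF assms(1) i] has_mean_valueD[OF assms(2) i]])
  then show ?thesis using integral_tent_pos[where 'a = "real ^ 'n"] by (simp add: integral_completion)
qed

lemma mean_value_eqI: "has_mean_value u m \<Longrightarrow> mean_value u = m"
  unfolding mean_value_def using has_mean_value_unique by blast

context mean_value_algebra
begin

abbreviation M :: "(real ^ 'n \<Rightarrow> real) \<Rightarrow> real" where "M \<equiv> mean_value"

lemma has_mean_value_M: "u \<in> A \<Longrightarrow> has_mean_value u (M u)"
  using has_mean mean_value_eqI by blast

lemma measurable: "u \<in> A \<Longrightarrow> u \<in> borel_measurable borel"
  by (intro borel_measurable_continuous_onI continuous)

lemma integrable_dilate_mult:
  assumes u: "u \<in> A" and g: "integrable lebesgue g"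
  shows "integrable lebesgue (\<lambda>x. u (x /\<^sub>R \<epsilon>) * g x)"
proof -
  obtain B where B: "\<And>x. \<bar>u x\<bar> \<le> B" using bounded_on_rangeE[OF bounded[OF u]] by metis
  have [measurable]: "u \<in> borel_measurable borel" using u by (rule measurable)
  have "(\<lambda>x. u (x /\<^sub>R \<epsilon>)) \<in> borel_measurable lborel" by measurable
  then have [measurable]: "(\<lambda>x. u (x /\<^sub>R \<epsilon>)) \<in> borel_measurable lebesgue" by (rule measurable_completion)
  have [measurable]: "g \<in> borel_measurable lebesgue" using g by auto
  show ?thesis
  proof (rule Bochner_Integration.integrable_bound)
    show "integrable lebesgue (\<lambda>x. B * g x)" using g by simp
    show "AE x in lebesgue. norm (u (x /\<^sub>R \<epsilon>) * g x) \<le> norm (B * g x)"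
    proof (rule AE_I2)
      fix x
      have "\<bar>u (x /\<^sub>R \<epsilon>)\<bar> \<le> \<bar>B\<bar>" using B[of "x /\<^sub>R \<epsilon>"] by linarith
      then show "norm (u (x /\<^sub>R \<epsilon>) * g x) \<le> norm (B * g x)"
        by (simp add: abs_mult mult_right_mono)
    qed
  qed measurable
qed

lemma M_add:
  assumes u: "u \<in> A" and v: "v \<in> A"
  shows "M (\<lambda>x. u x + v x) = M u + M v"
proof (rule mean_value_eqI, unfold has_mean_value_def, intro allI impI)
  fix g :: "real ^ 'n \<Rightarrow> real" assume g: "integrable lebesgue g"
  have "((\<lambda>\<epsilon>. (LINT x|lebesgue. u (x /\<^sub>R \<epsilon>) * g x) + (LINT x|lebesgue. v (x /\<^sub>R \<epsilon>) * g x))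
      \<longlongrightarrow> (LINT x|lebesgue. M u * g x) + (LINT x|lebesgue. M v * g x)) (at_right 0)"
    using u v g by (intro tendsto_add has_mean_valueD has_mean_value_M)
  then show "((\<lambda>\<epsilon>. LINT x|lebesgue. (u (x /\<^sub>R \<epsilon>) + v (x /\<^sub>R \<epsilon>)) * g x)
      \<longlongrightarrow> (LINT x|lebesgue. (M u + M v) * g x)) (at_right 0)"
    using integrable_dilate_mult[OF u g] integrable_dilate_mult[OF v g] g
    by (simp add: distrib_right)
qed

lemma M_scale:
  assumes u: "u \<in> A"
  shows "M (\<lambda>x. c * u x) = c * M u"
proof (rule mean_value_eqI, unfold has_mean_value_def, intro allI impI)
  fix g :: "real ^ 'n \<Rightarrow> real" assume g: "integrable lebesgue g"
  have "((\<lambda>\<epsilon>. c * (LINT x|lebesgue. u (x /\<^sub>R \<epsilon>) * g x)) \<longlongrightarrow> c * (LINT x|lebesgue. M u * g x)) (at_right 0)"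
    using u g by (intro tendsto_mult_left has_mean_valueD has_mean_value_M)
  then show "((\<lambda>\<epsilon>. LINT x|lebesgue. c * u (x /\<^sub>R \<epsilon>) * g x) \<longlongrightarrow> (LINT x|lebesgue. c * M u * g x)) (at_right 0)"
    by (simp add: mult.assoc)
qed

lemma M_const: "M (\<lambda>x. c) = c"
  by (rule mean_value_eqI) (simp add: has_mean_value_def)

lemma M_nonneg:
  assumes u: "u \<in> A" "\<And>x. u x \<ge> 0"
  shows "M u \<ge> 0"
proof -
  have "0 \<le> M u * (LINT x|lborel. tent (x :: real ^ 'n))"
  proof (rule tendsto_lowerbound[OF has_mean_value_tent[OF has_mean_value_M measurable]])
    show "\<forall>\<^sub>F \<epsilon> in at_right 0. 0 \<le> (LINT x|lborel. u (x /\<^sub>R \<epsilon>) * tent x)"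
      by (intro always_eventually allI integral_nonneg_AE AE_I2 mult_nonneg_nonneg u(2) tent_nonneg)
  qed (use u in auto)
  then show ?thesis using integral_tent_pos[where 'a = "real ^ 'n"] by (simp add: zero_le_mult_iff)
qed

lemma M_translate:
  assumes u: "u \<in> A"
  shows "M (translate a u) = M u"
proof -
  let ?I = "\<lambda>u \<epsilon>. LINT x|lborel. u (x /\<^sub>R \<epsilon>) * tent (x :: real ^ 'n)"
  obtain B where B: "B > 0" "\<And>x. \<bar>u x\<bar> \<le> B" using bounded_on_rangeE[OF bounded[OF u]] by metis
  have [measurable]: "u \<in> borel_measurable borel" using u by (rule measurable)
  define V where "V = measure lborel (cball (0 :: real ^ 'n) (1 + norm a))"
  have bound: "\<bar>?I (translate a u) \<epsilon> - ?I u \<epsilon>\<bar> \<le> \<epsilon> * (B * norm a * V)" if \<epsilon>: "0 < \<epsilon>" "\<epsilon> < 1" for \<epsilon> :: real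
  proof -
    let ?h = "\<epsilon> *\<^sub>R a"
    have int: "integrable lborel (\<lambda>x. u (x /\<^sub>R \<epsilon>) * tent x)"
      using integrable_dilate_mult[OF u, of tent \<epsilon>] integrable_tent[where 'a = "real ^ 'n"]
      by (simp add: integrable_completion)
    have int': "integrable lborel (\<lambda>x. u (x /\<^sub>R \<epsilon>) * tent (x - ?h))"
    proof (rule Bochner_Integration.integrable_bound)
      have "integrable lborel (\<lambda>x. tent (-?h + x))"
        using integrable_tent[where 'a = "real ^ 'n"]
        by (subst (asm) lborel_distr_plus[of "-?h", symmetric]) (simp add: integrable_distr_eq)
      then show "integrable lborel (\<lambda>x. B * tent (x - ?h))" by simp
      show "AE x in lborel. norm (u (x /\<^sub>R \<epsilon>) * tent (x - ?h)) \<le> norm (B * tent (x - ?h))"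
        using B by (intro AE_I2) (simp add: abs_mult mult_right_mono)
    qed measurable
    have "?I (translate a u) \<epsilon> = (LINT x|lborel. u ((?h + x) /\<^sub>R \<epsilon>) * tent ((?h + x) - ?h))"
      using \<epsilon> by (simp add: translate_def scaleR_add_right add.commute)
    also have "\<dots> = (LINT x|distr lborel borel ((+) ?h). u (x /\<^sub>R \<epsilon>) * tent (x - ?h))"
      by (subst integral_distr) auto
    also have "\<dots> = (LINT x|lborel. u (x /\<^sub>R \<epsilon>) * tent (x - ?h))"
      by (simp add: lborel_distr_plus)
    finally have "?I (translate a u) \<epsilon> - ?I u \<epsilon> = (LINT x|lborel. u (x /\<^sub>R \<epsilon>) * (tent (x - ?h) - tent x))"
      using int int' by (simp add: right_diff_distrib)
    also have "\<bar>\<dots>\<bar> \<le> (LINT x|lborel. \<bar>u (x /\<^sub>R \<epsilon>) * (tent (x - ?h) - tent x)\<bar>)"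
      by (rule integral_abs_bound)
    also have "\<dots> \<le> (LINT x|lborel. B * (\<epsilon> * norm a) * indicator (cball (0 :: real ^ 'n) (1 + norm a)) x)"
    proof (rule integral_mono)
      show "integrable lborel (\<lambda>x. \<bar>u (x /\<^sub>R \<epsilon>) * (tent (x - ?h) - tent x)\<bar>)"
        using int int' by (intro integrable_abs) (simp add: right_diff_distrib)
      show "integrable lborel (\<lambda>x. B * (\<epsilon> * norm a) * indicator (cball (0 :: real ^ 'n) (1 + norm a)) x :: real)"
        by (intro integrable_mult_right integrable_indicator_cball)
      fix x :: "real ^ 'n"
      have nh: "norm ?h = \<epsilon> * norm a" "norm ?h \<le> norm a"
        using \<epsilon> by (auto intro: mult_left_le_one_le)
      then have "cball (0 :: real ^ 'n) (1 + norm ?h) \<subseteq> cball 0 (1 + norm a)" by (intro subset_cball) simp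
      then have "\<bar>tent (x - ?h) - tent x\<bar> \<le> \<epsilon> * norm a * indicator (cball (0 :: real ^ 'n) (1 + norm a)) x"
      proof -
        assume "cball (0 :: real ^ 'n) (1 + norm ?h) \<subseteq> cball 0 (1 + norm a)"
        then have "norm ?h * indicator (cball 0 (1 + norm ?h)) x \<le> norm ?h * indicator (cball (0 :: real ^ 'n) (1 + norm a)) x"
          by (intro mult_left_mono norm_ge_zero) (auto split: split_indicator)
        then show ?thesis using tent_translate_diff[of x ?h] unfolding nh(1)[symmetric] by linarith
      qed
      then have "\<bar>u (x /\<^sub>R \<epsilon>)\<bar> * \<bar>tent (x - ?h) - tent x\<bar> \<le> B * (\<epsilon> * norm a * indicator (cball (0 :: real ^ 'n) (1 + norm a)) x)"
        using B by (intro mult_mono) auto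
      then show "\<bar>u (x /\<^sub>R \<epsilon>) * (tent (x - ?h) - tent x)\<bar> \<le> B * (\<epsilon> * norm a) * indicator (cball (0 :: real ^ 'n) (1 + norm a)) x"
        by (simp add: abs_mult mult.assoc)
    qed
    also have "\<dots> = \<epsilon> * (B * norm a * V)" by (simp add: V_def)
    finally show ?thesis .
  qed
  have "((\<lambda>\<epsilon>. ?I (translate a u) \<epsilon> - ?I u \<epsilon>) \<longlongrightarrow> 0) (at_right 0)"
  proof (rule Lim_null_comparison)
    have "\<forall>\<^sub>F \<epsilon> in at_right (0::real). 0 < \<epsilon> \<and> \<epsilon> < 1"
      using eventually_at_right_real[of 0 1] by (auto elim: eventually_mono)
    then show "\<forall>\<^sub>F \<epsilon> in at_right 0. norm (?I (translate a u) \<epsilon> - ?I u \<epsilon>) \<le> \<epsilon> * (B * norm a * V)"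
      by (rule eventually_mono) (use bound in simp)
    show "((\<lambda>\<epsilon>. \<epsilon> * (B * norm a * V)) \<longlongrightarrow> 0) (at_right 0)"
      by (rule tendsto_mult_left_zero) simp
  qed
  moreover have "((\<lambda>\<epsilon>. ?I (translate a u) \<epsilon> - ?I u \<epsilon>) \<longlongrightarrow>
      M (translate a u) * (LINT x|lborel. tent (x :: real ^ 'n)) - M u * (LINT x|lborel. tent (x :: real ^ 'n))) (at_right 0)"
    using u by (intro tendsto_diff has_mean_value_tent has_mean_value_M measurable translate)
  ultimately have "M (translate a u) * (LINT x|lborel. tent (x :: real ^ 'n)) - M u * (LINT x|lborel. tent (x :: real ^ 'n)) = 0"
    by (intro tendsto_unique[OF trivial_limit_at_right_real])
  then show ?thesis using integral_tent_pos[where 'a = "real ^ 'n"] by simp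
qed

end

section \<open>Introverted algebras\<close>

lemma ex_dense_sequence: "\<exists>q :: nat \<Rightarrow> 'a::{second_countable_topology}. closure (range q) = UNIV"
proof -
  obtain D :: "'a set" where D: "countable D" "\<And>U. \<lbrakk>open U; U \<noteq> {}\<rbrakk> \<Longrightarrow> \<exists>d\<in>D. d \<in> U"
    using countable_dense_exists by metis
  have "D \<noteq> {}" using D(2)[of UNIV] by auto
  have "x \<in> closure D" for x
    unfolding closure_iff_nhds_not_empty using D(2) by blast
  then have "closure (range (from_nat_into D)) = UNIV"
    using range_from_nat_into[OF \<open>D \<noteq> {}\<close> D(1)] by auto
  then show ?thesis by blast
qed

locale introverted_algebra = mean_value_algebra A
  for A :: "(real ^ 'n \<Rightarrow> real) set" +
  assumes introverted: "introverted A"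
    and commutative: "\<lbrakk>\<mu> \<in> \<Delta>; \<nu> \<in> \<Delta>\<rbrakk> \<Longrightarrow> spectrum_mult A \<mu> \<nu> = spectrum_mult A \<nu> \<mu>"
begin

abbreviation star :: "((real ^ 'n \<Rightarrow> real) \<Rightarrow> real) \<Rightarrow> ((real ^ 'n \<Rightarrow> real) \<Rightarrow> real) \<Rightarrow> (real ^ 'n \<Rightarrow> real) \<Rightarrow> real"
    (infixl "\<star>" 70) where
  "\<mu> \<star> \<nu> \<equiv> spectrum_mult A \<mu> \<nu>"

lemma introversion_in [simp]: "\<lbrakk>\<mu> \<in> \<Delta>; f \<in> A\<rbrakk> \<Longrightarrow> introversion \<mu> f \<in> A"
  using introverted by (simp add: introverted_def)

lemma star_apply: "f \<in> A \<Longrightarrow> (\<mu> \<star> \<nu>) f = \<mu> (introversion \<nu> f)"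
  by (simp add: spectrum_mult_def)

lemma introversion_add:
  assumes "\<nu> \<in> \<Delta>" "f \<in> A" "g \<in> A"
  shows "introversion \<nu> (\<lambda>x. f x + g x) = (\<lambda>x. introversion \<nu> f x + introversion \<nu> g x)"
  using char_add[OF assms(1) translate[OF assms(2)] translate[OF assms(3)]]
  by (simp add: introversion_def Defs.translate_def)

lemma introversion_mult:
  assumes "\<nu> \<in> \<Delta>" "f \<in> A" "g \<in> A"
  shows "introversion \<nu> (\<lambda>x. f x * g x) = (\<lambda>x. introversion \<nu> f x * introversion \<nu> g x)"
  using char_mult[OF assms(1) translate[OF assms(2)] translate[OF assms(3)]]
  by (simp add: introversion_def Defs.translate_def)

lemma introversion_scale:
  assumes "\<nu> \<in> \<Delta>" "f \<in> A"
  shows "introversion \<nu> (\<lambda>x. c * f x) = (\<lambda>x. c * introversion \<nu> f x)"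
  using char_scale[OF assms(1) translate[OF assms(2)]]
  by (simp add: introversion_def Defs.translate_def)

lemma introversion_one: "\<nu> \<in> \<Delta> \<Longrightarrow> introversion \<nu> (\<lambda>x. 1) = (\<lambda>x. 1)"
  by (simp add: introversion_def Defs.translate_def char_const)

lemma translate_introversion: "translate a (introversion \<nu> f) = introversion \<nu> (translate a f)"
  by (simp add: introversion_def Defs.translate_def add.assoc)

lemma star_in [simp]:
  assumes \<mu>: "\<mu> \<in> \<Delta>" and \<nu>: "\<nu> \<in> \<Delta>"
  shows "\<mu> \<star> \<nu> \<in> \<Delta>"
proof -
  have "\<mu> \<star> \<nu> \<in> extensional A" by (simp add: spectrum_mult_def)
  moreover have "(\<mu> \<star> \<nu>) (\<lambda>x. f x + g x) = (\<mu> \<star> \<nu>) f + (\<mu> \<star> \<nu>) g" if fg: "f \<in> A" "g \<in> A" for f g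
    unfolding star_apply[OF add[OF fg]] star_apply[OF fg(1)] star_apply[OF fg(2)] introversion_add[OF \<nu> fg]
    using fg \<nu> by (intro char_add[OF \<mu>] introversion_in)
  moreover have "(\<mu> \<star> \<nu>) (\<lambda>x. f x * g x) = (\<mu> \<star> \<nu>) f * (\<mu> \<star> \<nu>) g" if fg: "f \<in> A" "g \<in> A" for f g
    unfolding star_apply[OF mult[OF fg]] star_apply[OF fg(1)] star_apply[OF fg(2)] introversion_mult[OF \<nu> fg]
    using fg \<nu> by (intro char_mult[OF \<mu>] introversion_in)
  moreover have "(\<mu> \<star> \<nu>) (\<lambda>x. c * f x) = c * (\<mu> \<star> \<nu>) f" if f: "f \<in> A" for f c
    unfolding star_apply[OF scale[OF f]] star_apply[OF f] introversion_scale[OF \<nu> f]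
    using f \<nu> by (intro char_scale[OF \<mu>] introversion_in)
  moreover have "(\<mu> \<star> \<nu>) (\<lambda>x. 1) \<noteq> 0"
    unfolding star_apply[OF const] introversion_one[OF \<nu>] char_const[OF \<mu>] by simp
  then have "\<exists>u\<in>A. (\<mu> \<star> \<nu>) u \<noteq> 0" using const by (rule bexI)
  ultimately show ?thesis unfolding spectrum_def mem_Collect_eq by (intro conjI ballI allI)
qed

lemma introversion_star:
  assumes "f \<in> A"
  shows "introversion (\<mu> \<star> \<nu>) f = introversion \<mu> (introversion \<nu> f)"
proof
  fix x
  have "introversion (\<mu> \<star> \<nu>) f x = \<mu> (introversion \<nu> (translate x f))"
    using star_apply[OF translate[OF assms]] by (simp add: introversion_def)
  also have "\<dots> = introversion \<mu> (introversion \<nu> f) x"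
    unfolding translate_introversion[symmetric] by (simp add: introversion_def)
  finally show "introversion (\<mu> \<star> \<nu>) f x = introversion \<mu> (introversion \<nu> f) x" .
qed

lemma star_assoc:
  assumes "\<mu> \<in> \<Delta>" "\<nu> \<in> \<Delta>" "\<rho> \<in> \<Delta>"
  shows "\<mu> \<star> \<nu> \<star> \<rho> = \<mu> \<star> (\<nu> \<star> \<rho>)"
proof (rule char_eqI)
  fix f assume f: "f \<in> A"
  show "(\<mu> \<star> \<nu> \<star> \<rho>) f = (\<mu> \<star> (\<nu> \<star> \<rho>)) f"
    unfolding star_apply[OF f] introversion_star[OF f] star_apply[OF introversion_in[OF assms(3) f]] ..
qed (use assms in simp_all)

lemma star_\<delta>: "f \<in> A \<Longrightarrow> (\<mu> \<star> \<delta> x) f = \<mu> (translate x f)"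
proof -
  assume f: "f \<in> A"
  have "introversion (\<delta> x) f y = translate x f y" for y
    using \<delta>_apply[OF translate[OF f, of y], of x]
    by (simp add: introversion_def Defs.translate_def add.commute)
  then have "introversion (\<delta> x) f = translate x f" ..
  then show ?thesis by (simp add: star_apply[OF f])
qed

lemma \<delta>_star: "\<lbrakk>\<nu> \<in> \<Delta>; f \<in> A\<rbrakk> \<Longrightarrow> (\<delta> x \<star> \<nu>) f = introversion \<nu> f x"
  by (simp add: star_apply)

lemma continuous_star:
  assumes \<mu>: "\<mu> \<in> \<Delta>"
  shows "continuous_map X X (\<lambda>\<nu>. \<mu> \<star> \<nu>)"
proof (rule continuous_into_X)
  fix f assume f: "f \<in> A"
  show "continuous_map X euclideanreal (\<lambda>\<nu>. (\<mu> \<star> \<nu>) f)"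
  proof (rule continuous_map_eq[OF continuous_eval[OF introversion_in[OF \<mu> f]]])
    fix \<nu> assume "\<nu> \<in> topspace X"
    then have "\<mu> \<star> \<nu> = \<nu> \<star> \<mu>" using \<mu> by (intro commutative) auto
    then show "\<nu> (introversion \<mu> f) = (\<mu> \<star> \<nu>) f" using star_apply[OF f] by simp
  qed
qed (use \<mu> in simp)

definition dense_seq :: "nat \<Rightarrow> real ^ 'n" where
  "dense_seq = (SOME q. closure (range q) = UNIV)"

lemma closure_range_dense_seq: "closure (range dense_seq) = UNIV"
  unfolding dense_seq_def using ex_dense_sequence by (rule someI_ex)

sublocale semigroup: separable_compact_semigroup X "spectrum_mult A" "\<lambda>n. \<delta> (dense_seq n)"
proof
  show "X closure_of range (\<lambda>n. \<delta> (dense_seq n)) = topspace X"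
    using \<delta>_dense[OF closure_range_dense_seq] by (simp add: image_image)
  show "\<mu> \<star> \<nu> = \<nu> \<star> \<mu>" if "\<mu> \<in> topspace X" "\<nu> \<in> topspace X" for \<mu> \<nu>
    using that unfolding topspace_X by (rule commutative)
  show "\<mu> \<star> \<nu> \<star> \<rho> = \<mu> \<star> (\<nu> \<star> \<rho>)" if "\<mu> \<in> topspace X" "\<nu> \<in> topspace X" "\<rho> \<in> topspace X" for \<mu> \<nu> \<rho>
    using that unfolding topspace_X by (rule star_assoc)
qed (simp_all add: compact_X Hausdorff_X continuous_star)

lemma kernel_eq: "semigroup.kernel = spectrum_kernel A"
  by (simp add: semigroup.kernel_def spectrum_kernel_def)

lemma kgroup_eq: "semigroup.kgroup = kernel_group A"
  by (simp add: semigroup.kgroup_def kernel_group_def kernel_eq)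

lemma Y_eq: "semigroup.Y = kernel_topology A"
  by (simp add: semigroup.Y_def kernel_topology_def kernel_eq)

lemma positive_functional_X: "positive_functional X (\<lambda>\<phi>. M (\<lambda>x. \<phi> (\<delta> x)))"
proof
  show "M (\<lambda>x. f (\<delta> x) + g (\<delta> x)) = M (\<lambda>x. f (\<delta> x)) + M (\<lambda>x. g (\<delta> x))"
    if "continuous_map X euclideanreal f" "continuous_map X euclideanreal g" for f g
    using that by (intro M_add gelfand_onto)
  show "M (\<lambda>x. c * f (\<delta> x)) = c * M (\<lambda>x. f (\<delta> x))" if "continuous_map X euclideanreal f" for f c
    using that by (intro M_scale gelfand_onto)
  show "0 \<le> M (\<lambda>x. f (\<delta> x))"
    if "continuous_map X euclideanreal f" "\<And>x. x \<in> topspace X \<Longrightarrow> 0 \<le> f x" for f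
    using that by (intro M_nonneg gelfand_onto) simp_all
qed (fact compact_X Hausdorff_X)+

text \<open>\<open>introversion \<mu> f\<close> is, along a sequence of translates of \<open>f\<close>, a bounded pointwise limit on the
  whole spectrum; representing \<open>M\<close> by a measure on the spectrum makes dominated convergence
  applicable.\<close>

lemma M_introversion:
  assumes \<mu>: "\<mu> \<in> \<Delta>" and f: "f \<in> A"
  shows "M (introversion \<mu> f) = M f"
proof -
  interpret R: positive_functional X "\<lambda>\<phi>. M (\<lambda>x. \<phi> (\<delta> x))" by (rule positive_functional_X)
  have sp: "space R.riesz = \<Delta>"
    using R.riesz_borel by (simp add: borel_measure_on_def)
  interpret finite_measure R.riesz by (rule R.finite_riesz)
  have int: "(LINT s|R.riesz. s u) = M u" if u: "u \<in> A" for u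
    using R.riesz_integral[OF continuous_eval[OF u]] by (simp add: u)
  obtain p where p: "range p \<subseteq> range (\<lambda>n. \<delta> (dense_seq n))"
      "\<And>s. s \<in> \<Delta> \<Longrightarrow> (\<lambda>k. (p k \<star> s) f) \<longlonglongrightarrow> (\<mu> \<star> s) f"
    using semigroup.dense_sequence[OF continuous_eval[OF f], of \<mu>] \<mu> unfolding topspace_X by blast
  have "\<exists>y. p k = \<delta> y" for k using p(1) by auto
  then obtain y where y: "\<And>k. p k = \<delta> (y k)" by metis
  obtain B where B: "\<And>x. \<bar>f x\<bar> \<le> B" using bounded_on_rangeE[OF bounded[OF f]] by metis
  have eq: "(p k \<star> s) f = s (translate (y k) f)" if s: "s \<in> \<Delta>" for k s
    using commutative[OF \<delta>_in s] star_\<delta>[OF f] by (simp add: y)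
  have eq\<mu>: "(\<mu> \<star> s) f = s (introversion \<mu> f)" if s: "s \<in> \<Delta>" for s
    using commutative[OF \<mu> s] star_apply[OF f] by simp
  have "(\<lambda>k. LINT s|R.riesz. s (translate (y k) f)) \<longlonglongrightarrow> (LINT s|R.riesz. s (introversion \<mu> f))"
  proof (rule integral_dominated_convergence[where w = "\<lambda>_. B"])
    show "(\<lambda>s. s (introversion \<mu> f)) \<in> borel_measurable R.riesz"
      using \<mu> f by (intro borel_measure_on_measurable[OF R.riesz_borel] continuous_eval introversion_in)
    show "(\<lambda>s. s (translate (y k) f)) \<in> borel_measurable R.riesz" for k
      using f by (intro borel_measure_on_measurable[OF R.riesz_borel] continuous_eval translate)
    show "AE s in R.riesz. (\<lambda>k. s (translate (y k) f)) \<longlonglongrightarrow> s (introversion \<mu> f)"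
    proof (rule AE_I2)
      fix s assume "s \<in> space R.riesz"
      then have s: "s \<in> \<Delta>" by (simp add: sp)
      show "(\<lambda>k. s (translate (y k) f)) \<longlonglongrightarrow> s (introversion \<mu> f)"
        using p(2)[OF s] unfolding eq[OF s] eq\<mu>[OF s] .
    qed
    show "AE s in R.riesz. norm (s (translate (y k) f)) \<le> B" for k
    proof (rule AE_I2)
      fix s assume "s \<in> space R.riesz"
      then have s: "s \<in> \<Delta>" by (simp add: sp)
      show "norm (s (translate (y k) f)) \<le> B"
        unfolding real_norm_def
        by (rule char_bound[OF s translate[OF f]]) (simp add: Defs.translate_def B)
    qed
  qed simp
  moreover have "(LINT s|R.riesz. s (translate (y k) f)) = M f" for k
    using int[OF translate[OF f]] M_translate[OF f] by simp
  ultimately have "(\<lambda>k. M f) \<longlonglongrightarrow> M (introversion \<mu> f)"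
    unfolding int[OF introversion_in[OF \<mu> f]] by simp
  then show ?thesis using LIMSEQ_const_iff[of "M f" "M (introversion \<mu> f)"] by simp
qed

abbreviation e :: "(real ^ 'n \<Rightarrow> real) \<Rightarrow> real" where
  "e \<equiv> \<one>\<^bsub>semigroup.kgroup\<^esub>"

lemma e_in: "e \<in> semigroup.kernel"
  using semigroup.kernel_identity by blast

lemma e_in_\<Delta> [simp]: "e \<in> \<Delta>"
  using semigroup.kernel_S[OF e_in] by simp

lemma in_\<Delta>: "g \<in> semigroup.kernel \<Longrightarrow> g \<in> \<Delta>"
  using semigroup.kernel_S by simp

lemma retract_in:
  assumes "continuous_map semigroup.Y euclideanreal \<phi>"
  shows "(\<lambda>x. \<phi> (e \<star> \<delta> x)) \<in> A" and "s \<in> \<Delta> \<Longrightarrow> s (\<lambda>x. \<phi> (e \<star> \<delta> x)) = \<phi> (e \<star> s)"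
proof -
  note cont = semigroup.cont_extend[OF assms]
  show "(\<lambda>x. \<phi> (e \<star> \<delta> x)) \<in> A" by (rule gelfand_onto(1)[OF cont])
  show "s \<in> \<Delta> \<Longrightarrow> s (\<lambda>x. \<phi> (e \<star> \<delta> x)) = \<phi> (e \<star> s)" by (rule gelfand_onto(2)[OF cont])
qed

lemma positive_functional_kernel: "positive_functional semigroup.Y (\<lambda>\<phi>. M (\<lambda>x. \<phi> (e \<star> \<delta> x)))"
proof
  show "M (\<lambda>x. f (e \<star> \<delta> x) + g (e \<star> \<delta> x)) = M (\<lambda>x. f (e \<star> \<delta> x)) + M (\<lambda>x. g (e \<star> \<delta> x))"
    if "continuous_map semigroup.Y euclideanreal f" "continuous_map semigroup.Y euclideanreal g" for f g
    using that by (intro M_add retract_in)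
  show "M (\<lambda>x. c * f (e \<star> \<delta> x)) = c * M (\<lambda>x. f (e \<star> \<delta> x))" if "continuous_map semigroup.Y euclideanreal f" for f c
    using that by (intro M_scale retract_in)
  show "0 \<le> M (\<lambda>x. f (e \<star> \<delta> x))"
    if "continuous_map semigroup.Y euclideanreal f" "\<And>x. x \<in> topspace semigroup.Y \<Longrightarrow> 0 \<le> f x" for f
  proof (intro M_nonneg retract_in that)
    fix x
    have "\<delta> x \<star> e \<in> semigroup.kernel" using e_in by (intro semigroup.kernel_ideal) simp_all
    then show "e \<star> \<delta> x \<in> topspace semigroup.Y" using commutative[OF e_in_\<Delta> \<delta>_in] by simp
  qed
qed (fact semigroup.compact_Y semigroup.Hausdorff_Y)+

lemma functional_kernel_eval:
  assumes f: "f \<in> A"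
  shows "M (\<lambda>x. (e \<star> \<delta> x) f) = M f"
proof -
  have "(\<lambda>x. (e \<star> \<delta> x) f) = introversion e f"
    using commutative[OF e_in_\<Delta> \<delta>_in] \<delta>_star[OF e_in_\<Delta> f] by auto
  then show ?thesis using M_introversion[OF e_in_\<Delta> f] by simp
qed

lemma functional_kernel_invariant:
  assumes \<phi>: "continuous_map semigroup.Y euclideanreal \<phi>" and g: "g \<in> semigroup.kernel"
  shows "M (\<lambda>x. (\<phi> \<circ> (\<lambda>s. g \<star> s)) (e \<star> \<delta> x)) = M (\<lambda>x. \<phi> (e \<star> \<delta> x))"
proof -
  let ?u = "\<lambda>x. \<phi> (e \<star> \<delta> x)"
  note u = retract_in(1)[OF \<phi>] and gD = in_\<Delta>[OF g]
  have "(\<phi> \<circ> (\<lambda>s. g \<star> s)) (e \<star> \<delta> x) = introversion g ?u x" for x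
  proof -
    have "g \<star> (e \<star> \<delta> x) = e \<star> (\<delta> x \<star> g)"
      using star_assoc[OF gD e_in_\<Delta> \<delta>_in] star_assoc[OF e_in_\<Delta> gD \<delta>_in]
        commutative[OF gD e_in_\<Delta>] commutative[OF gD \<delta>_in] by simp
    then show ?thesis
      using retract_in(2)[OF \<phi> star_in[OF \<delta>_in gD]] \<delta>_star[OF gD u] by simp
  qed
  then have "M (\<lambda>x. (\<phi> \<circ> (\<lambda>s. g \<star> s)) (e \<star> \<delta> x)) = M (introversion g ?u)" by simp
  then show ?thesis using M_introversion[OF gD u] by simp
qed

lemma normalized_haar_measure_exists:
  "\<exists>\<beta>. normalized_haar_measure (kernel_group A) (kernel_topology A) \<beta> \<and>
    (\<forall>f\<in>A. (LINT s|\<beta>. s f) = M f)"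
proof -
  interpret R: positive_functional semigroup.Y "\<lambda>\<phi>. M (\<lambda>x. \<phi> (e \<star> \<delta> x))"
    by (rule positive_functional_kernel)
  interpret G: group semigroup.kgroup by (rule semigroup.group_kgroup)
  have b: "space R.riesz = topspace semigroup.Y"
      "sets R.riesz = sigma_sets (topspace semigroup.Y) {U. openin semigroup.Y U}"
    using R.riesz_borel unfolding borel_measure_on_def by auto
  have one: "emeasure R.riesz (space R.riesz) = 1"
    unfolding b R.emeasure_riesz_open[OF openin_topspace] R.content_topspace M_const by simp
  have inv: "emeasure R.riesz ((\<lambda>s. g \<star> s) ` B) = emeasure R.riesz B"
    if g: "g \<in> semigroup.kernel" and B: "B \<in> sets R.riesz" for g B
  proof (rule R.emeasure_riesz_homeo[OF _ _ B])
    let ?h = "inv\<^bsub>semigroup.kgroup\<^esub> g"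
    have h: "?h \<in> semigroup.kernel" using G.inv_closed g by simp
    have hg: "?h \<star> g = e" "g \<star> ?h = e" using G.l_inv G.r_inv g by simp_all
    show "homeomorphic_maps semigroup.Y semigroup.Y (\<lambda>s. g \<star> s) (\<lambda>s. ?h \<star> s)"
      unfolding homeomorphic_maps_def
    proof (intro conjI ballI semigroup.cont_left_Y g h)
      fix s assume "s \<in> topspace semigroup.Y"
      then have s: "s \<in> semigroup.kernel" by simp
      show "?h \<star> (g \<star> s) = s" "g \<star> (?h \<star> s) = s"
        using star_assoc[OF in_\<Delta>[OF h] in_\<Delta>[OF g] in_\<Delta>[OF s]] star_assoc[OF in_\<Delta>[OF g] in_\<Delta>[OF h] in_\<Delta>[OF s]]
          hg semigroup.kernel_identity s by simp_all
    qed
  qed (rule functional_kernel_invariant[OF _ g])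
  have "normalized_haar_measure semigroup.kgroup semigroup.Y R.riesz"
    unfolding normalized_haar_measure_def semigroup.kgroup_simps
    using R.riesz_outer_regular R.riesz_inner_regular inv
    by (intro conjI ballI allI impI b one) simp_all
  moreover have "(LINT s|R.riesz. s f) = M f" if f: "f \<in> A" for f
    using R.riesz_integral[OF semigroup.cont_Y[OF continuous_eval[OF f]]] functional_kernel_eval[OF f] by simp
  ultimately show ?thesis unfolding kgroup_eq Y_eq by blast
qed

lemma mean_value_eq_haar_integral:
  assumes \<beta>: "normalized_haar_measure (kernel_group A) (kernel_topology A) \<beta>" and f: "f \<in> A"
  shows "M f = (LINT s|\<beta>. s f)"
proof -
  obtain \<beta>0 where \<beta>0: "normalized_haar_measure (kernel_group A) (kernel_topology A) \<beta>0"
      "(LINT s|\<beta>0. s f) = M f"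
    using normalized_haar_measure_exists f by blast
  show ?thesis
    using semigroup.haar_integral_unique[unfolded kgroup_eq Y_eq, OF \<beta> \<beta>0(1)]
      semigroup.cont_Y[OF continuous_eval[OF f]] \<beta>0(2) unfolding Y_eq by simp
qed

end

theorem theorem4:
  fixes A :: "(real ^ 'n \<Rightarrow> real) set"
  assumes "algebra_with_mean_value A"
    and "introverted A"
    and commutative: "\<And>\<mu> \<nu>. \<mu> \<in> spectrum A \<Longrightarrow> \<nu> \<in> spectrum A \<Longrightarrow>
                        spectrum_mult A \<mu> \<nu> = spectrum_mult A \<nu> \<mu>"
  shows "compact_topological_group (kernel_group A) (kernel_topology A) \<and>
         (\<exists>\<beta>. normalized_haar_measure (kernel_group A) (kernel_topology A) \<beta>) \<and>
         (\<forall>\<beta>. normalized_haar_measure (kernel_group A) (kernel_topology A) \<beta> \<longrightarrow>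
            (\<forall>u\<in>A. mean_value u = (LINT s|\<beta>. gelfand u s)))"
proof -
  interpret introverted_algebra A
    by unfold_locales (use assms in auto)
  show ?thesis
    using semigroup.compact_topological_group_kernel normalized_haar_measure_exists mean_value_eq_haar_integral
    unfolding kgroup_eq Y_eq gelfand_def by blast
qed

end
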